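(* Let $A \supseteq B$ be a ring extension such that the natural right module $A_B$ is finitely generated projective. Then the separability idempotents of $A \supseteq B$ are in one-to-one correspondence with the bimodule projections $\mathcal{E} : \mathrm{End}(A_B) \to A$.
   Context: Rings are unital and associative, not necessarily commutative. A ring extension $A \supseteq B$ means that $B$ is a subring of $A$ with $1_B = 1_A$. A separability idempotent of $A \supseteq B$ is an element $e = e^1 \otimes_B e^2 \in A \otimes_B A$ (summation suppressed) with $ae = ea$ for all $a \in A$ and $e^1 e^2 = 1$. $\mathrm{End}(A_B)$ is the ring of right $B$-module endomorphisms of $A$; $A$ embeds in it as a subring via left multiplications $a \mapsto \lambda_a$, $\lambda_a(x) = ax$. A bimodule projection $\mathcal{E} : \mathrm{End}(A_B) \to A$ is an additive map such that $\mathcal{E}(\lambda_a \alpha \lambda_{a'}) = a\,\mathcal{E}(\alpha)\,a'$ for all $a, a' \in A$, $\alpha \in \mathrm{End}(A_B)$, and $\mathcal{E}(\mathrm{id}_A) = 1_A$ (hence $\mathcal{E}(\lambda_a) = a$ for all $a\in A$). *)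

theory Defs
  imports "HOL-Algebra.Module" "HOL-Algebra.Subrings" "HOL-Algebra.Free_Abelian_Groups"
begin

section \<open>Right modules\<close>

text \<open>
  The \<^locale>\<open>module\<close> locale only covers left modules over commutative rings, but its record type
  and the \<^locale>\<open>submodule\<close> predicate make sense over any ring. A right R-module M is represented
  by such a record in which \<open>r \<odot>\<^bsub>M\<^esub> x\<close> stands for the product of x with r on the right.
\<close>

definition right_module_hom ::
  "('r, 'k) ring_scheme \<Rightarrow> ('r, 'a, 'm) module_scheme \<Rightarrow> ('r, 'b, 'n) module_scheme \<Rightarrow> ('a \<Rightarrow> 'b) set"
  where "right_module_hom R M N =
    {f \<in> hom (add_monoid M) (add_monoid N).
       \<forall>r \<in> carrier R. \<forall>x \<in> carrier M. f (r \<odot>\<^bsub>M\<^esub> x) = r \<odot>\<^bsub>N\<^esub> f x}"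

definition free_right_module :: "('r, 'k) ring_scheme \<Rightarrow> 'i set \<Rightarrow> ('r, 'i \<Rightarrow> 'r) module"
  where "free_right_module R I =
    \<lparr>carrier = {f. (\<forall>i \<in> I. f i \<in> carrier R) \<and> (\<forall>i. i \<notin> I \<longrightarrow> f i = \<zero>\<^bsub>R\<^esub>) \<and> finite {i. f i \<noteq> \<zero>\<^bsub>R\<^esub>}},
     monoid.mult = undefined, one = undefined,
     ring.zero = (\<lambda>i. \<zero>\<^bsub>R\<^esub>), ring.add = (\<lambda>f g i. f i \<oplus>\<^bsub>R\<^esub> g i),
     smult = (\<lambda>r f i. f i \<otimes>\<^bsub>R\<^esub> r)\<rparr>"

definition finitely_generated_right_module ::
  "('r, 'k) ring_scheme \<Rightarrow> ('r, 'a, 'm) module_scheme \<Rightarrow> bool"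
  where "finitely_generated_right_module R M \<longleftrightarrow>
    (\<exists>S. finite S \<and> S \<subseteq> carrier M \<and>
       (\<forall>x \<in> carrier M. \<exists>c \<in> S \<rightarrow> carrier R. x = (\<Oplus>\<^bsub>M\<^esub>s\<in>S. c s \<odot>\<^bsub>M\<^esub> s)))"

text \<open>
  Projective means isomorphic to a direct summand of a free module: \<open>\<sigma>\<close> is the isomorphism onto
  the summand and Q is a complement. Bases indexed by subsets of the type of elements of M are enough
  in general, because M is a quotient of the free module on its own carrier.
\<close>

definition projective_right_module ::
  "('r, 'k) ring_scheme \<Rightarrow> ('r, 'a, 'm) module_scheme \<Rightarrow> bool"
  where "projective_right_module R M \<longleftrightarrow>
    (\<exists>(I :: 'a set) \<sigma> Q. let F = free_right_module R I in
       \<sigma> \<in> right_module_hom R M F \<and> inj_on \<sigma> (carrier M) \<and>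
       submodule Q R F \<and>
       \<sigma> ` carrier M \<inter> Q = {\<zero>\<^bsub>F\<^esub>} \<and>
       \<sigma> ` carrier M <+>\<^bsub>F\<^esub> Q = carrier F)"

definition right_module_End ::
  "('r, 'k) ring_scheme \<Rightarrow> ('r, 'a, 'm) module_scheme \<Rightarrow> ('a \<Rightarrow> 'a) ring"
  where "right_module_End R M =
    \<lparr>carrier = right_module_hom R M M \<inter> extensional (carrier M),
     monoid.mult = compose (carrier M), one = (\<lambda>x \<in> carrier M. x),
     ring.zero = (\<lambda>x \<in> carrier M. \<zero>\<^bsub>M\<^esub>), ring.add = (\<lambda>f g. \<lambda>x \<in> carrier M. f x \<oplus>\<^bsub>M\<^esub> g x)\<rparr>"


section \<open>Ring extensions\<close>

definition natural_right_module :: "('a, 'k) ring_scheme \<Rightarrow> ('a, 'a) module"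
  where "natural_right_module A =
    \<lparr>carrier = carrier A, monoid.mult = (\<otimes>\<^bsub>A\<^esub>), one = \<one>\<^bsub>A\<^esub>, ring.zero = \<zero>\<^bsub>A\<^esub>, ring.add = (\<oplus>\<^bsub>A\<^esub>),
     smult = (\<lambda>b x. x \<otimes>\<^bsub>A\<^esub> b)\<rparr>"

abbreviation extension_End :: "('a, 'k) ring_scheme \<Rightarrow> 'a set \<Rightarrow> ('a \<Rightarrow> 'a) ring"
  where "extension_End A B \<equiv> right_module_End (A\<lparr>carrier := B\<rparr>) (natural_right_module A)"

definition left_mult :: "('a, 'k) ring_scheme \<Rightarrow> 'a \<Rightarrow> 'a \<Rightarrow> 'a"
  where "left_mult A a = (\<lambda>x \<in> carrier A. a \<otimes>\<^bsub>A\<^esub> x)"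

text \<open>
  Projections are extensional functions, so that two of them are equal as soon as they agree on
  the endomorphism ring.
\<close>

definition bimodule_projections :: "('a, 'k) ring_scheme \<Rightarrow> 'a set \<Rightarrow> (('a \<Rightarrow> 'a) \<Rightarrow> 'a) set"
  where "bimodule_projections A B =
    {E \<in> hom (add_monoid (extension_End A B)) (add_monoid A) \<inter> extensional (carrier (extension_End A B)).
       (\<forall>a \<in> carrier A. \<forall>a' \<in> carrier A. \<forall>\<alpha> \<in> carrier (extension_End A B).
          E (left_mult A a \<otimes>\<^bsub>extension_End A B\<^esub> \<alpha> \<otimes>\<^bsub>extension_End A B\<^esub> left_mult A a')
            = a \<otimes>\<^bsub>A\<^esub> E \<alpha> \<otimes>\<^bsub>A\<^esub> a') \<and>
       E \<one>\<^bsub>extension_End A B\<^esub> = \<one>\<^bsub>A\<^esub>}"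


section \<open>The tensor square of a ring extension\<close>

abbreviation pairs_group :: "('a, 'k) ring_scheme \<Rightarrow> ('a \<times> 'a \<Rightarrow>\<^sub>0 int) monoid"
  where "pairs_group A \<equiv> free_Abelian_group (carrier A \<times> carrier A)"

definition tensor_relations :: "('a, 'k) ring_scheme \<Rightarrow> 'a set \<Rightarrow> ('a \<times> 'a \<Rightarrow>\<^sub>0 int) set"
  where "tensor_relations A B =
    {frag_of (x \<oplus>\<^bsub>A\<^esub> x', y) - frag_of (x, y) - frag_of (x', y) | x x' y.
       x \<in> carrier A \<and> x' \<in> carrier A \<and> y \<in> carrier A} \<union>
    {frag_of (x, y \<oplus>\<^bsub>A\<^esub> y') - frag_of (x, y) - frag_of (x, y') | x y y'.
       x \<in> carrier A \<and> y \<in> carrier A \<and> y' \<in> carrier A} \<union>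
    {frag_of (x \<otimes>\<^bsub>A\<^esub> b, y) - frag_of (x, b \<otimes>\<^bsub>A\<^esub> y) | x b y.
       x \<in> carrier A \<and> b \<in> B \<and> y \<in> carrier A}"

definition tensor_kernel :: "('a, 'k) ring_scheme \<Rightarrow> 'a set \<Rightarrow> ('a \<times> 'a \<Rightarrow>\<^sub>0 int) set"
  where "tensor_kernel A B = generate (pairs_group A) (tensor_relations A B)"

definition tensor_square :: "('a, 'k) ring_scheme \<Rightarrow> 'a set \<Rightarrow> ('a \<times> 'a \<Rightarrow>\<^sub>0 int) set monoid"
  where "tensor_square A B = pairs_group A Mod tensor_kernel A B"

definition pure_tensor :: "('a, 'k) ring_scheme \<Rightarrow> 'a set \<Rightarrow> 'a \<Rightarrow> 'a \<Rightarrow> ('a \<times> 'a \<Rightarrow>\<^sub>0 int) set"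
  where "pure_tensor A B x y = tensor_kernel A B #>\<^bsub>pairs_group A\<^esub> frag_of (x, y)"

definition pairs_extend ::
  "('a, 'k) ring_scheme \<Rightarrow> ('c, 'n) monoid_scheme \<Rightarrow> ('a \<Rightarrow> 'a \<Rightarrow> 'c) \<Rightarrow> ('a \<times> 'a \<Rightarrow>\<^sub>0 int) \<Rightarrow> 'c"
  where "pairs_extend A G g u =
    gfinprod G (\<lambda>(x, y). g x y [^]\<^bsub>G\<^esub> poly_mapping.lookup u (x, y)) (carrier A \<times> carrier A)"

text \<open>
  For a B-balanced biadditive map g into an abelian group G, \<open>tensor_lift A G g\<close> is the induced
  homomorphism from the tensor square to G. It sends a coset X to the common value on all elements of
  X of the additive extension of g; see \<open>tensor_lift_hom\<close> and
  \<open>tensor_lift_pure\<close> below.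
\<close>

definition tensor_lift ::
  "('a, 'k) ring_scheme \<Rightarrow> ('c, 'n) monoid_scheme \<Rightarrow> ('a \<Rightarrow> 'a \<Rightarrow> 'c) \<Rightarrow> ('a \<times> 'a \<Rightarrow>\<^sub>0 int) set \<Rightarrow> 'c"
  where "tensor_lift A G g X =
    the_elem (pairs_extend A G g ` X)"

definition tensor_left_act ::
  "('a, 'k) ring_scheme \<Rightarrow> 'a set \<Rightarrow> 'a \<Rightarrow> ('a \<times> 'a \<Rightarrow>\<^sub>0 int) set \<Rightarrow> ('a \<times> 'a \<Rightarrow>\<^sub>0 int) set"
  where "tensor_left_act A B a =
    tensor_lift A (tensor_square A B) (\<lambda>x y. pure_tensor A B (a \<otimes>\<^bsub>A\<^esub> x) y)"

definition tensor_right_act ::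
  "('a, 'k) ring_scheme \<Rightarrow> 'a set \<Rightarrow> ('a \<times> 'a \<Rightarrow>\<^sub>0 int) set \<Rightarrow> 'a \<Rightarrow> ('a \<times> 'a \<Rightarrow>\<^sub>0 int) set"
  where "tensor_right_act A B e a =
    tensor_lift A (tensor_square A B) (\<lambda>x y. pure_tensor A B x (y \<otimes>\<^bsub>A\<^esub> a)) e"

definition separability_idempotents ::
  "('a, 'k) ring_scheme \<Rightarrow> 'a set \<Rightarrow> ('a \<times> 'a \<Rightarrow>\<^sub>0 int) set set"
  where "separability_idempotents A B =
    {e \<in> carrier (tensor_square A B).
       (\<forall>a \<in> carrier A. tensor_left_act A B a e = tensor_right_act A B e a) \<and>
       tensor_lift A (add_monoid A) (\<lambda>x y. x \<otimes>\<^bsub>A\<^esub> y) e = \<one>\<^bsub>A\<^esub>}"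

text \<open>The map on endomorphisms sending \<open>\<alpha>\<close> to \<open>\<alpha>(e\<^sup>1) e\<^sup>2\<close>.\<close>

definition separability_projection ::
  "('a, 'k) ring_scheme \<Rightarrow> 'a set \<Rightarrow> ('a \<times> 'a \<Rightarrow>\<^sub>0 int) set \<Rightarrow> ('a \<Rightarrow> 'a) \<Rightarrow> 'a"
  where "separability_projection A B e =
    (\<lambda>\<alpha> \<in> carrier (extension_End A B). tensor_lift A (add_monoid A) (\<lambda>x y. \<alpha> x \<otimes>\<^bsub>A\<^esub> y) e)"


section \<open>Universal property of the tensor square\<close>

definition balanced_map ::
  "('a, 'k) ring_scheme \<Rightarrow> 'a set \<Rightarrow> ('c, 'n) monoid_scheme \<Rightarrow> ('a \<Rightarrow> 'a \<Rightarrow> 'c) \<Rightarrow> bool"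
  where "balanced_map A B G g \<longleftrightarrow>
    (\<forall>x \<in> carrier A. \<forall>y \<in> carrier A. g x y \<in> carrier G) \<and>
    (\<forall>x \<in> carrier A. \<forall>x' \<in> carrier A. \<forall>y \<in> carrier A. g (x \<oplus>\<^bsub>A\<^esub> x') y = g x y \<otimes>\<^bsub>G\<^esub> g x' y) \<and>
    (\<forall>x \<in> carrier A. \<forall>y \<in> carrier A. \<forall>y' \<in> carrier A. g x (y \<oplus>\<^bsub>A\<^esub> y') = g x y \<otimes>\<^bsub>G\<^esub> g x y') \<and>
    (\<forall>x \<in> carrier A. \<forall>b \<in> B. \<forall>y \<in> carrier A. g (x \<otimes>\<^bsub>A\<^esub> b) y = g x (b \<otimes>\<^bsub>A\<^esub> y))"

lemma pairs_extend_hom: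
  fixes A :: "('b, 'k) ring_scheme"
  assumes "comm_group G" and g: "\<forall>x \<in> carrier A. \<forall>y \<in> carrier A. g x y \<in> carrier G"
  shows "pairs_extend A G g \<in> hom (pairs_group A) G"
    and "x \<in> carrier A \<Longrightarrow> y \<in> carrier A \<Longrightarrow> pairs_extend A G g (frag_of (x, y)) = g x y"
proof -
  interpret G: comm_group G by fact
  let ?S = "carrier A \<times> carrier A"
  define f where "f = (\<lambda>p. g (fst p) (snd p))"
  have f: "f p \<in> carrier G" if "p \<in> ?S" for p
    using g that by (auto simp: f_def)
  have eq: "pairs_extend A G g u = gfinprod G (\<lambda>p. f p [^]\<^bsub>G\<^esub> poly_mapping.lookup u p) ?S" for u
    unfolding pairs_extend_def f_def by (rule arg_cong [where f = "\<lambda>h. gfinprod G h ?S"]) auto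
  have fin: "finite {p \<in> ?S. f p [^]\<^bsub>G\<^esub> poly_mapping.lookup u p \<noteq> \<one>\<^bsub>G\<^esub>}" for u :: "'b \<times> 'b \<Rightarrow>\<^sub>0 int"
    by (rule finite_subset [OF _ finite_keys [of u]]) (auto simp: in_keys_iff)
  show "pairs_extend A G g \<in> hom (pairs_group A) G"
  proof (rule homI)
    fix u v
    assume "u \<in> carrier (pairs_group A)" "v \<in> carrier (pairs_group A)"
    have "pairs_extend A G g (u + v) =
        gfinprod G (\<lambda>p. f p [^]\<^bsub>G\<^esub> poly_mapping.lookup u p \<otimes>\<^bsub>G\<^esub> f p [^]\<^bsub>G\<^esub> poly_mapping.lookup v p) ?S"
      unfolding eq
      by (rule G.gfinprod_cong) (use f in \<open>auto simp: lookup_add G.int_pow_mult simp_implies_def\<close>)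
    also have "\<dots> = pairs_extend A G g u \<otimes>\<^bsub>G\<^esub> pairs_extend A G g v"
      unfolding eq by (rule G.gfinprod_distrib [OF fin fin]) (use f in auto)
    finally show "pairs_extend A G g (u \<otimes>\<^bsub>pairs_group A\<^esub> v) = pairs_extend A G g u \<otimes>\<^bsub>G\<^esub> pairs_extend A G g v"
      by simp
  qed (unfold eq, intro G.gfinprod_closed, use f in auto)
  assume "x \<in> carrier A" "y \<in> carrier A"
  then have p: "(x, y) \<in> ?S" by simp
  have "pairs_extend A G g (frag_of (x, y)) = gfinprod G f {(x, y)}"
    unfolding eq
    by (rule sym, rule G.gfinprod_mono_neutral_cong_left) (use f p in auto)
  also have "\<dots> = f (x, y)"
    using f [OF p] by (simp add: G.finprod_singleton)
  finally show "pairs_extend A G g (frag_of (x, y)) = g x y"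
    by (simp add: f_def)
qed

lemma tensor_relations_subset:
  assumes "ring A" "subring B A"
  shows "tensor_relations A B \<subseteq> carrier (pairs_group A)"
proof -
  interpret A: ring A by fact
  have "B \<subseteq> carrier A" using assms subringE(1) by blast
  then have b: "\<And>b. b \<in> B \<Longrightarrow> b \<in> carrier A" by blast
  have d: "u - v \<in> carrier (pairs_group A)"
    if "u \<in> carrier (pairs_group A)" "v \<in> carrier (pairs_group A)" for u v
    using that keys_diff [of u v] by auto
  show ?thesis
    unfolding tensor_relations_def
    by (intro Un_least subsetI; elim CollectE exE conjE; hypsubst; intro d) (simp_all add: b)
qed

lemma tensor_kernel_normal:
  assumes "ring A" "subring B A"
  shows "tensor_kernel A B \<lhd> pairs_group A"
  using abelian_free_Abelian_group tensor_relations_subset [OF assms]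
  unfolding tensor_kernel_def
  by (metis comm_group.normal_iff_subgroup group.generate_is_subgroup group_free_Abelian_group)

lemma tensor_square_comm_group:
  assumes "ring A" "subring B A"
  shows "comm_group (tensor_square A B)"
  unfolding tensor_square_def
  by (metis abelian_free_Abelian_group assms comm_group.abelian_FactGroup
      normal_imp_subgroup tensor_kernel_normal)

lemma pure_tensor_closed:
  assumes "x \<in> carrier A" "y \<in> carrier A"
  shows "pure_tensor A B x y \<in> carrier (tensor_square A B)"
  using assms by (auto simp: pure_tensor_def tensor_square_def FactGroup_def RCOSETS_def)

lemma tensor_kernel_vanish:
  assumes A: "ring A" "subring B A" and G: "comm_group G" and g: "balanced_map A B G g"
  shows "u \<in> tensor_kernel A B \<Longrightarrow> pairs_extend A G g u = \<one>\<^bsub>G\<^esub>"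
proof -
  interpret A: ring A by fact
  interpret G: comm_group G by fact
  let ?h = "pairs_extend A G g"
  have gc: "\<forall>x \<in> carrier A. \<forall>y \<in> carrier A. g x y \<in> carrier G"
    using g by (simp add: balanced_map_def)
  note h = pairs_extend_hom [OF G gc]
  interpret h: group_hom "pairs_group A" G ?h
    using h(1) by (simp add: group_hom_def group_hom_axioms_def)
  have BA: "B \<subseteq> carrier A" using A subringE(1) by blast
  have diff: "?h (u - v) = ?h u \<otimes>\<^bsub>G\<^esub> inv\<^bsub>G\<^esub> ?h v"
    if "u \<in> carrier (pairs_group A)" "v \<in> carrier (pairs_group A)" for u v
    using that h.hom_mult [of u "inv\<^bsub>pairs_group A\<^esub> v"] h.hom_inv [of v]
    by (simp add: inv_free_Abelian_group)
  have dc: "u - v \<in> carrier (pairs_group A)"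
    if "u \<in> carrier (pairs_group A)" "v \<in> carrier (pairs_group A)" for u v
    using that keys_diff [of u v] by auto
  have fc: "frag_of (x, y) \<in> carrier (pairs_group A)" if "x \<in> carrier A" "y \<in> carrier A" for x y
    using that by simp
  have cancel3: "a \<otimes>\<^bsub>G\<^esub> b \<otimes>\<^bsub>G\<^esub> inv\<^bsub>G\<^esub> a \<otimes>\<^bsub>G\<^esub> inv\<^bsub>G\<^esub> b = \<one>\<^bsub>G\<^esub>"
    if "a \<in> carrier G" "b \<in> carrier G" for a b
    using that by (metis G.inv_mult G.inv_closed G.m_assoc G.m_closed G.r_inv)
  have rel: "?h r = \<one>\<^bsub>G\<^esub>" if "r \<in> tensor_relations A B" for r
    using that unfolding tensor_relations_def
  proof (elim UnE CollectE exE conjE)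
    fix x x' y
    assume r: "r = frag_of (x \<oplus>\<^bsub>A\<^esub> x', y) - frag_of (x, y) - frag_of (x', y)"
      and c: "x \<in> carrier A" "x' \<in> carrier A" "y \<in> carrier A"
    have "?h r = g x y \<otimes>\<^bsub>G\<^esub> g x' y \<otimes>\<^bsub>G\<^esub> inv\<^bsub>G\<^esub> g x y \<otimes>\<^bsub>G\<^esub> inv\<^bsub>G\<^esub> g x' y"
      using c g by (simp add: r diff dc fc h(2) balanced_map_def del: carrier_free_Abelian_group_iff)
    then show ?thesis using c gc cancel3 by simp
  next
    fix x y y'
    assume r: "r = frag_of (x, y \<oplus>\<^bsub>A\<^esub> y') - frag_of (x, y) - frag_of (x, y')"
      and c: "x \<in> carrier A" "y \<in> carrier A" "y' \<in> carrier A"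
    have "?h r = g x y \<otimes>\<^bsub>G\<^esub> g x y' \<otimes>\<^bsub>G\<^esub> inv\<^bsub>G\<^esub> g x y \<otimes>\<^bsub>G\<^esub> inv\<^bsub>G\<^esub> g x y'"
      using c g by (simp add: r diff dc fc h(2) balanced_map_def del: carrier_free_Abelian_group_iff)
    then show ?thesis using c gc cancel3 by simp
  next
    fix x b y
    assume r: "r = frag_of (x \<otimes>\<^bsub>A\<^esub> b, y) - frag_of (x, b \<otimes>\<^bsub>A\<^esub> y)"
      and c: "x \<in> carrier A" "b \<in> B" "y \<in> carrier A"
    have b: "b \<in> carrier A" using c BA by blast
    have "g (x \<otimes>\<^bsub>A\<^esub> b) y = g x (b \<otimes>\<^bsub>A\<^esub> y)" using c g by (simp add: balanced_map_def)
    moreover have "?h r = g (x \<otimes>\<^bsub>A\<^esub> b) y \<otimes>\<^bsub>G\<^esub> inv\<^bsub>G\<^esub> g x (b \<otimes>\<^bsub>A\<^esub> y)"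
      using c b by (simp add: r diff dc fc h(2) del: carrier_free_Abelian_group_iff)
    ultimately show ?thesis using c b gc by simp
  qed
  have "tensor_relations A B \<subseteq> kernel (pairs_group A) G ?h"
    using rel tensor_relations_subset [OF A]
    by (auto simp: kernel_def subset_iff simp del: carrier_free_Abelian_group_iff)
  then have "tensor_kernel A B \<subseteq> kernel (pairs_group A) G ?h"
    unfolding tensor_kernel_def
    by (metis group.generate_subgroup_incl group_free_Abelian_group h.subgroup_kernel)
  then show "u \<in> tensor_kernel A B \<Longrightarrow> ?h u = \<one>\<^bsub>G\<^esub>"
    by (auto simp: kernel_def)
qed

lemma tensor_lift_coset:
  assumes A: "ring A" "subring B A" and G: "comm_group G" and g: "balanced_map A B G g"
    and u: "u \<in> carrier (pairs_group A)"
  shows "tensor_lift A G g (tensor_kernel A B #>\<^bsub>pairs_group A\<^esub> u) = pairs_extend A G g u"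
proof -
  interpret G: comm_group G by fact
  let ?h = "pairs_extend A G g" and ?K = "tensor_kernel A B"
  have h: "?h \<in> hom (pairs_group A) G"
    using pairs_extend_hom(1) [OF G] g by (auto simp: balanced_map_def)
  interpret K: normal ?K "pairs_group A" by (rule tensor_kernel_normal [OF A])
  have val: "?h (k \<otimes>\<^bsub>pairs_group A\<^esub> u) = ?h u" if "k \<in> ?K" for k
    using hom_mult [OF h K.mem_carrier [OF that] u] tensor_kernel_vanish [OF A G g that]
      hom_in_carrier [OF h u] by simp
  have "?h ` (?K #>\<^bsub>pairs_group A\<^esub> u) = {?h u}"
  proof
    show "?h ` (?K #>\<^bsub>pairs_group A\<^esub> u) \<subseteq> {?h u}"
      using val by (auto simp: r_coset_def simp del: mult_free_Abelian_group)
    show "{?h u} \<subseteq> ?h ` (?K #>\<^bsub>pairs_group A\<^esub> u)"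
      using K.rcos_self [OF u K.is_subgroup] by blast
  qed
  then show ?thesis
    by (simp add: tensor_lift_def)
qed

lemma tensor_lift_pure:
  assumes "ring A" "subring B A" "comm_group G" "balanced_map A B G g"
    and "x \<in> carrier A" "y \<in> carrier A"
  shows "tensor_lift A G g (pure_tensor A B x y) = g x y"
  using assms tensor_lift_coset [OF assms(1-4), of "frag_of (x, y)"] pairs_extend_hom(2) [OF assms(3), of A g x y]
  unfolding pure_tensor_def by (simp add: balanced_map_def)

lemma tensor_lift_hom:
  assumes A: "ring A" "subring B A" and G: "comm_group G" and g: "balanced_map A B G g"
  shows "tensor_lift A G g \<in> hom (tensor_square A B) G"
proof -
  let ?h = "pairs_extend A G g" and ?K = "tensor_kernel A B"
  have h: "?h \<in> hom (pairs_group A) G"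
    using pairs_extend_hom(1) [OF G] g by (auto simp: balanced_map_def)
  interpret K: normal ?K "pairs_group A" by (rule tensor_kernel_normal [OF A])
  have rep: "\<exists>u \<in> carrier (pairs_group A). X = ?K #>\<^bsub>pairs_group A\<^esub> u"
    if "X \<in> carrier (tensor_square A B)" for X
    using that by (auto simp: tensor_square_def FactGroup_def RCOSETS_def)
  show ?thesis
  proof (rule homI)
    fix X assume "X \<in> carrier (tensor_square A B)"
    then obtain u where u: "u \<in> carrier (pairs_group A)" "X = ?K #>\<^bsub>pairs_group A\<^esub> u"
      using rep by blast
    then show "tensor_lift A G g X \<in> carrier G"
      using tensor_lift_coset [OF A G g u(1)] hom_in_carrier [OF h u(1)] by simp
  next
    fix X Y assume "X \<in> carrier (tensor_square A B)" "Y \<in> carrier (tensor_square A B)"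
    then obtain u v where u: "u \<in> carrier (pairs_group A)" "X = ?K #>\<^bsub>pairs_group A\<^esub> u"
      and v: "v \<in> carrier (pairs_group A)" "Y = ?K #>\<^bsub>pairs_group A\<^esub> v"
      using rep by blast
    have XY: "X \<otimes>\<^bsub>tensor_square A B\<^esub> Y = ?K #>\<^bsub>pairs_group A\<^esub> (u \<otimes>\<^bsub>pairs_group A\<^esub> v)"
      using K.rcos_sum [OF u(1) v(1)] u(2) v(2) by (simp add: tensor_square_def)
    have uv: "u \<otimes>\<^bsub>pairs_group A\<^esub> v \<in> carrier (pairs_group A)"
      using u(1) v(1) by (intro monoid.m_closed group.is_monoid group_free_Abelian_group)
    show "tensor_lift A G g (X \<otimes>\<^bsub>tensor_square A B\<^esub> Y) = tensor_lift A G g X \<otimes>\<^bsub>G\<^esub> tensor_lift A G g Y"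
      using hom_mult [OF h u(1) v(1)]
      by (simp only: XY tensor_lift_coset [OF A G g uv])
        (simp only: u(2) v(2) tensor_lift_coset [OF A G g u(1)] tensor_lift_coset [OF A G g v(1)])
  qed
qed

end

theory Submission
  imports Defs
begin

text \<open>
  A finitely generated projective module \<open>A\<^sub>B\<close> has a finite dual basis: elements \<open>x\<^sub>j\<close> of \<open>A\<close> and right
  \<open>B\<close>-linear maps \<open>f\<^sub>j\<close> from \<open>A\<close> to \<open>B\<close> such that \<open>a = \<Sum>\<^sub>j x\<^sub>j f\<^sub>j(a)\<close> for all \<open>a\<close>
  (\<open>projective_right_module_dual_basis\<close>). Everything else follows from studying the pairing
  \<open>\<langle>\<alpha>, t\<rangle> = \<alpha>(t\<^sup>1) t\<^sup>2\<close> of right \<open>B\<close>-linear maps \<open>\<alpha>\<close> with tensors \<open>t\<close>, called contraction below.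

  The pairing turns the two actions on tensors into operations on endomorphisms and on values:
  \<open>\<langle>\<alpha>, at\<rangle> = \<langle>\<alpha>\<lambda>\<^sub>a, t\<rangle>\<close> and \<open>\<langle>\<alpha>, ta\<rangle> = \<langle>\<alpha>, t\<rangle>a\<close>, while \<open>\<langle>\<lambda>\<^sub>a\<alpha>, t\<rangle> = a\<langle>\<alpha>, t\<rangle>\<close> always holds.
  So if \<open>ae = ea\<close> for all \<open>a\<close>, the map \<open>\<langle>-, e\<rangle>\<close> is a bimodule map, and \<open>e\<^sup>1e\<^sup>2 = 1\<close> says that it sends the
  identity to 1.

  The dual basis makes the pairing perfect. On the one hand each tensor is
  \<open>t = \<Sum>\<^sub>j x\<^sub>j \<otimes> \<langle>f\<^sub>j, t\<rangle>\<close> (\<open>tensor_expand\<close>), because for \<open>t = u \<otimes> v\<close> the scalar \<open>f\<^sub>j(u)\<close> lies in \<open>B\<close> and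
  moves across the tensor sign. Hence a tensor is determined by its contractions (\<open>tensor_eqI\<close>), which
  gives injectivity. On the other hand each endomorphism is \<open>\<alpha> = \<Sum>\<^sub>j \<lambda>\<^bsub>\<alpha>(x\<^sub>j)\<^esub> f\<^sub>j\<close>
  (\<open>endomorphism_expand\<close>), so a projection \<open>E\<close> satisfies \<open>E(\<alpha>) = \<Sum>\<^sub>j \<alpha>(x\<^sub>j) E(f\<^sub>j) = \<langle>\<alpha>, e\<rangle>\<close> for
  \<open>e = \<Sum>\<^sub>j x\<^sub>j \<otimes> E(f\<^sub>j)\<close>. That \<open>e\<close> is a separability idempotent is now read off from contractions:
  \<open>\<langle>\<alpha>, ae\<rangle> = E(\<alpha>\<lambda>\<^sub>a) = E(\<alpha>)a = \<langle>\<alpha>, ea\<rangle>\<close> for every \<open>\<alpha>\<close>, and \<open>e\<^sup>1e\<^sup>2 = E(id) = 1\<close>.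
\<close>

section \<open>Homomorphisms and finite sums\<close>

lemma hom_finprod:
  assumes "comm_group G" "comm_group H" "h \<in> hom G H" "g \<in> I \<rightarrow> carrier G"
  shows "h (finprod G g I) = finprod H (\<lambda>i. h (g i)) I"
proof -
  interpret G: comm_group G by fact
  interpret H: comm_group H by fact
  interpret h: group_hom G H h
    using assms(3) by (simp add: group_hom_def group_hom_axioms_def)
  show ?thesis
    using assms(4)
  proof (induction I rule: infinite_finite_induct)
    case (insert i I)
    then have "g i \<in> carrier G" "g \<in> I \<rightarrow> carrier G" "(\<lambda>i. h (g i)) \<in> I \<rightarrow> carrier H"
      by (auto simp: Pi_iff)
    then show ?case
      using insert by simp
  qed simp_all
qed

text \<open>
  Sums are products in the additive group; groups that are written multiplicatively, such as the tensor
  square, and additive groups of rings both occur as source and target below.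
\<close>

lemma hom_finsum:
  assumes "abelian_group M" "abelian_group N" "h \<in> hom (add_monoid M) (add_monoid N)"
    and "g \<in> I \<rightarrow> carrier M"
  shows "h (finsum M g I) = finsum N (\<lambda>i. h (g i)) I"
  using hom_finprod [of "add_monoid M" "add_monoid N" h g I] assms
  by (simp add: finsum_def abelian_group.a_comm_group)

lemma finprod_of_homs:
  assumes "group G" "comm_group H" "\<And>i. i \<in> I \<Longrightarrow> h i \<in> hom G H"
  shows "(\<lambda>x. finprod H (\<lambda>i. h i x) I) \<in> hom G H"
proof -
  interpret G: group G by fact
  interpret H: comm_group H by fact
  have c: "(\<lambda>i. h i x) \<in> I \<rightarrow> carrier H" if "x \<in> carrier G" for x
    using assms(3) that by (auto intro: hom_in_carrier)
  show ?thesis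
  proof (rule homI)
    fix x y assume xy: "x \<in> carrier G" "y \<in> carrier G"
    have "finprod H (\<lambda>i. h i (x \<otimes>\<^bsub>G\<^esub> y)) I = finprod H (\<lambda>i. h i x \<otimes>\<^bsub>H\<^esub> h i y) I"
      by (rule H.finprod_cong')
        (use c [OF xy(1)] c [OF xy(2)] xy in \<open>auto simp: hom_mult [OF assms(3)]\<close>)
    then show "finprod H (\<lambda>i. h i (x \<otimes>\<^bsub>G\<^esub> y)) I
        = finprod H (\<lambda>i. h i x) I \<otimes>\<^bsub>H\<^esub> finprod H (\<lambda>i. h i y) I"
      using H.finprod_multf [OF c [OF xy(1)] c [OF xy(2)]] by simp
  qed (use c in simp)
qed


section \<open>Dual bases\<close>

lemma right_module_homD:
  assumes "f \<in> right_module_hom R M N"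
  shows "f \<in> hom (add_monoid M) (add_monoid N)"
    and "x \<in> carrier M \<Longrightarrow> f x \<in> carrier N"
    and "x \<in> carrier M \<Longrightarrow> y \<in> carrier M \<Longrightarrow> f (x \<oplus>\<^bsub>M\<^esub> y) = f x \<oplus>\<^bsub>N\<^esub> f y"
    and "r \<in> carrier R \<Longrightarrow> x \<in> carrier M \<Longrightarrow> f (r \<odot>\<^bsub>M\<^esub> x) = r \<odot>\<^bsub>N\<^esub> f x"
  using assms by (auto simp: right_module_hom_def hom_def)

lemma right_module_homI:
  assumes "\<And>x. x \<in> carrier M \<Longrightarrow> f x \<in> carrier N"
    and "\<And>x y. x \<in> carrier M \<Longrightarrow> y \<in> carrier M \<Longrightarrow> f (x \<oplus>\<^bsub>M\<^esub> y) = f x \<oplus>\<^bsub>N\<^esub> f y"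
    and "\<And>r x. r \<in> carrier R \<Longrightarrow> x \<in> carrier M \<Longrightarrow> f (r \<odot>\<^bsub>M\<^esub> x) = r \<odot>\<^bsub>N\<^esub> f x"
  shows "f \<in> right_module_hom R M N"
  using assms by (auto simp: right_module_hom_def hom_def)

lemma natural_right_module_simps [simp]:
  "carrier (natural_right_module R) = carrier R"
  "x \<oplus>\<^bsub>natural_right_module R\<^esub> y = x \<oplus>\<^bsub>R\<^esub> y"
  "\<zero>\<^bsub>natural_right_module R\<^esub> = \<zero>\<^bsub>R\<^esub>"
  "r \<odot>\<^bsub>natural_right_module R\<^esub> x = x \<otimes>\<^bsub>R\<^esub> r"
  by (simp_all add: natural_right_module_def)

lemma natural_right_module_abelian_group:
  assumes "ring R"
  shows "abelian_group (natural_right_module R)"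
proof -
  interpret R: ring R by fact
  show ?thesis
    by (rule abelian_groupI) (auto simp: R.a_ac intro: R.l_neg R.a_inv_closed)
qed

lemma free_right_module_abelian_group:
  assumes "ring R"
  shows "abelian_group (free_right_module R I)"
proof -
  interpret R: ring R by fact
  show ?thesis
  proof (rule abelian_groupI)
    fix f g assume fg: "f \<in> carrier (free_right_module R I)" "g \<in> carrier (free_right_module R I)"
    then have "{i. f i \<oplus>\<^bsub>R\<^esub> g i \<noteq> \<zero>\<^bsub>R\<^esub>} \<subseteq> {i. f i \<noteq> \<zero>\<^bsub>R\<^esub>} \<union> {i. g i \<noteq> \<zero>\<^bsub>R\<^esub>}"
      by auto
    with fg show "f \<oplus>\<^bsub>free_right_module R I\<^esub> g \<in> carrier (free_right_module R I)"
      by (auto simp: free_right_module_def intro: finite_subset)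
  next
    fix f assume f: "f \<in> carrier (free_right_module R I)"
    then have c: "f i \<in> carrier R" for i by (cases "i \<in> I") (auto simp: free_right_module_def)
    have "{i. \<ominus>\<^bsub>R\<^esub> f i \<noteq> \<zero>\<^bsub>R\<^esub>} \<subseteq> {i. f i \<noteq> \<zero>\<^bsub>R\<^esub>}" by auto
    with f have "(\<lambda>i. \<ominus>\<^bsub>R\<^esub> f i) \<in> carrier (free_right_module R I)"
      by (auto simp: free_right_module_def intro: finite_subset)
    then show "\<exists>g \<in> carrier (free_right_module R I). g \<oplus>\<^bsub>free_right_module R I\<^esub> f = \<zero>\<^bsub>free_right_module R I\<^esub>"
      by (rule bexI [rotated]) (simp add: free_right_module_def R.l_neg c)
  next
    fix f g h assume "f \<in> carrier (free_right_module R I)" "g \<in> carrier (free_right_module R I)"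
      "h \<in> carrier (free_right_module R I)"
    then have "f i \<in> carrier R" "g i \<in> carrier R" "h i \<in> carrier R" for i
      by (cases "i \<in> I"; auto simp: free_right_module_def)+
    then show "f \<oplus>\<^bsub>free_right_module R I\<^esub> g \<oplus>\<^bsub>free_right_module R I\<^esub> h
        = f \<oplus>\<^bsub>free_right_module R I\<^esub> (g \<oplus>\<^bsub>free_right_module R I\<^esub> h)"
      by (simp add: free_right_module_def R.a_assoc)
  next
    fix f g assume "f \<in> carrier (free_right_module R I)" "g \<in> carrier (free_right_module R I)"
    then have "f i \<in> carrier R" "g i \<in> carrier R" for i
      by (cases "i \<in> I"; auto simp: free_right_module_def)+
    then show "f \<oplus>\<^bsub>free_right_module R I\<^esub> g = g \<oplus>\<^bsub>free_right_module R I\<^esub> f"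
      by (simp add: free_right_module_def R.a_comm)
  next
    fix f assume "f \<in> carrier (free_right_module R I)"
    then have "f i \<in> carrier R" for i
      by (cases "i \<in> I"; auto simp: free_right_module_def)+
    then show "\<zero>\<^bsub>free_right_module R I\<^esub> \<oplus>\<^bsub>free_right_module R I\<^esub> f = f"
      by (simp add: free_right_module_def)
  qed (simp add: free_right_module_def)
qed

lemma free_right_module_coordinate:
  assumes "ring R"
  shows "(\<lambda>f. f i) \<in> right_module_hom R (free_right_module R I) (natural_right_module R)"
proof -
  interpret R: ring R by fact
  show ?thesis
    by (rule right_module_homI; cases "i \<in> I") (auto simp: free_right_module_def)
qed

definition unit_vector :: "('r, 'k) ring_scheme \<Rightarrow> 'i \<Rightarrow> 'i \<Rightarrow> 'r"
  where "unit_vector R i = (\<lambda>j. if j = i then \<one>\<^bsub>R\<^esub> else \<zero>\<^bsub>R\<^esub>)"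

lemma unit_vector_closed:
  assumes "ring R" "i \<in> I"
  shows "unit_vector R i \<in> carrier (free_right_module R I)"
proof -
  interpret R: ring R by fact
  have "{j. unit_vector R i j \<noteq> \<zero>\<^bsub>R\<^esub>} \<subseteq> {i}" by (auto simp: unit_vector_def)
  with assms(2) show ?thesis
    by (auto simp: free_right_module_def unit_vector_def intro: finite_subset)
qed

lemma free_right_module_smult_closed:
  assumes "ring R" "r \<in> carrier R" "f \<in> carrier (free_right_module R I)"
  shows "r \<odot>\<^bsub>free_right_module R I\<^esub> f \<in> carrier (free_right_module R I)"
proof -
  interpret R: ring R by fact
  have "{i. f i \<otimes>\<^bsub>R\<^esub> r \<noteq> \<zero>\<^bsub>R\<^esub>} \<subseteq> {i. f i \<noteq> \<zero>\<^bsub>R\<^esub>}" using assms by auto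
  with assms show ?thesis
    by (auto simp: free_right_module_def intro: finite_subset)
qed

lemma free_right_module_expand:
  assumes R: "ring R" and J: "finite J" "J \<subseteq> I"
    and f: "f \<in> carrier (free_right_module R I)" and supp: "\<And>i. i \<notin> J \<Longrightarrow> f i = \<zero>\<^bsub>R\<^esub>"
  shows "f = (\<Oplus>\<^bsub>free_right_module R I\<^esub>i\<in>J. f i \<odot>\<^bsub>free_right_module R I\<^esub> unit_vector R i)"
proof
  interpret R: ring R by fact
  let ?F = "free_right_module R I"
  interpret N: abelian_group "natural_right_module R" by (rule natural_right_module_abelian_group [OF R])
  interpret F: abelian_group ?F by (rule free_right_module_abelian_group [OF R])
  fix j
  have fc: "f i \<in> carrier R" for i
    using f by (cases "i \<in> I") (auto simp: free_right_module_def)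
  have "(\<lambda>i. f i \<odot>\<^bsub>?F\<^esub> unit_vector R i) \<in> J \<rightarrow> carrier ?F"
    using fc J by (auto intro!: free_right_module_smult_closed unit_vector_closed R)
  then have "(\<Oplus>\<^bsub>?F\<^esub>i\<in>J. f i \<odot>\<^bsub>?F\<^esub> unit_vector R i) j
      = (\<Oplus>\<^bsub>natural_right_module R\<^esub>i\<in>J. (f i \<odot>\<^bsub>?F\<^esub> unit_vector R i) j)"
    using hom_finsum [OF F.abelian_group_axioms N.abelian_group_axioms
        right_module_homD(1) [OF free_right_module_coordinate [OF R]]] by blast
  also have "\<dots> = (\<Oplus>\<^bsub>natural_right_module R\<^esub>i\<in>J. if j = i then f i else \<zero>\<^bsub>natural_right_module R\<^esub>)"
    by (rule N.finsum_cong') (use fc in \<open>auto simp: free_right_module_def unit_vector_def\<close>)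
  also have "\<dots> = f j"
  proof (cases "j \<in> J")
    case True
    then show ?thesis using N.finsum_singleton [OF True J(1), of f] fc by auto
  next
    case False
    then have "(\<Oplus>\<^bsub>natural_right_module R\<^esub>i\<in>J. if j = i then f i else \<zero>\<^bsub>natural_right_module R\<^esub>)
       = (\<Oplus>\<^bsub>natural_right_module R\<^esub>i\<in>J. \<zero>\<^bsub>natural_right_module R\<^esub>)"
      by (intro N.finsum_cong') auto
    then show ?thesis using supp [OF False] N.finsum_zero [of J] by simp
  qed
  finally show "f j = (\<Oplus>\<^bsub>?F\<^esub>i\<in>J. f i \<odot>\<^bsub>?F\<^esub> unit_vector R i) j" by simp
qed

text \<open>
  The coordinate maps have the ring as their target, so inside a ring extension their values lie in
  the subring.
\<close>

definition right_dual_basis ::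
  "('r, 'k) ring_scheme \<Rightarrow> ('r, 'a, 'm) module_scheme \<Rightarrow> 'i set \<Rightarrow> ('i \<Rightarrow> 'a) \<Rightarrow> ('i \<Rightarrow> 'a \<Rightarrow> 'r) \<Rightarrow> bool"
  where "right_dual_basis R M J x f \<longleftrightarrow>
    finite J \<and> x \<in> J \<rightarrow> carrier M \<and> f \<in> J \<rightarrow> right_module_hom R M (natural_right_module R) \<and>
    (\<forall>m \<in> carrier M. m = (\<Oplus>\<^bsub>M\<^esub>j\<in>J. f j m \<odot>\<^bsub>M\<^esub> x j))"

text \<open>
  The images of the finitely many generators have finite supports, and the union of these supports
  contains the support of every linear combination. This replaces a possibly infinite basis of the
  free module by a finite part of it.
\<close>

lemma finitely_generated_image_support:
  assumes R: "ring R" and M: "abelian_group M"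
    and smult: "\<And>r m. r \<in> carrier R \<Longrightarrow> m \<in> carrier M \<Longrightarrow> r \<odot>\<^bsub>M\<^esub> m \<in> carrier M"
    and fg: "finitely_generated_right_module R M"
    and \<sigma>: "\<sigma> \<in> right_module_hom R M (free_right_module R I)"
  obtains J where "finite J" "J \<subseteq> I" "\<And>m i. m \<in> carrier M \<Longrightarrow> i \<notin> J \<Longrightarrow> \<sigma> m i = \<zero>\<^bsub>R\<^esub>"
proof -
  interpret R: ring R by fact
  interpret M: abelian_group M by fact
  let ?F = "free_right_module R I"
  interpret N: abelian_group "natural_right_module R" by (rule natural_right_module_abelian_group [OF R])
  obtain S where S: "finite S" "S \<subseteq> carrier M"
    and gen: "\<And>m. m \<in> carrier M \<Longrightarrow> \<exists>c \<in> S \<rightarrow> carrier R. m = (\<Oplus>\<^bsub>M\<^esub>s\<in>S. c s \<odot>\<^bsub>M\<^esub> s)"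
    using fg unfolding finitely_generated_right_module_def by metis
  define J where "J = (\<Union>s\<in>S. {i. \<sigma> s i \<noteq> \<zero>\<^bsub>R\<^esub>})"
  have \<sigma>F: "\<sigma> s \<in> carrier ?F" if "s \<in> S" for s
    using right_module_homD(2) [OF \<sigma>] S that by blast
  show thesis
  proof
    show "finite J" using S(1) \<sigma>F by (auto simp: J_def free_right_module_def)
    show "J \<subseteq> I" using \<sigma>F by (fastforce simp: J_def free_right_module_def)
    fix m i assume m: "m \<in> carrier M" and i: "i \<notin> J"
    obtain c where c: "c \<in> S \<rightarrow> carrier R" "m = (\<Oplus>\<^bsub>M\<^esub>s\<in>S. c s \<odot>\<^bsub>M\<^esub> s)" using gen [OF m] by blast
    define h where "h = (\<lambda>m. \<sigma> m i)"
    have h: "h \<in> right_module_hom R M (natural_right_module R)"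
      using right_module_homD(2-4) [OF \<sigma>] right_module_homD(2-4) [OF free_right_module_coordinate [OF R, of i I]]
      unfolding h_def by (intro right_module_homI) auto
    have "h m = (\<Oplus>\<^bsub>natural_right_module R\<^esub>s\<in>S. h (c s \<odot>\<^bsub>M\<^esub> s))"
      unfolding c(2)
      by (rule hom_finsum [OF M N.abelian_group_axioms right_module_homD(1) [OF h]])
        (use smult S c in auto)
    also have "\<dots> = (\<Oplus>\<^bsub>natural_right_module R\<^esub>s\<in>S. \<zero>\<^bsub>natural_right_module R\<^esub>)"
    proof (rule N.finsum_cong')
      fix s assume s: "s \<in> S"
      then have "h s = \<zero>\<^bsub>R\<^esub>" using i by (auto simp: J_def h_def)
      then show "h (c s \<odot>\<^bsub>M\<^esub> s) = \<zero>\<^bsub>natural_right_module R\<^esub>"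
        using right_module_homD(4) [OF h, of "c s" s] c(1) S s by (auto simp: Pi_iff)
    qed auto
    also have "\<dots> = \<zero>\<^bsub>R\<^esub>" using N.finsum_zero [of S] by simp
    finally show "\<sigma> m i = \<zero>\<^bsub>R\<^esub>" by (simp add: h_def)
  qed
qed

lemma (in abelian_group) finsum_in_subgroup:
  assumes "subgroup Q (add_monoid G)" "g \<in> J \<rightarrow> Q"
  shows "finsum G g J \<in> Q"
proof -
  interpret Q: subgroup Q "add_monoid G" by fact
  show ?thesis
    using assms(2)
  proof (induction J rule: infinite_finite_induct)
    case (insert i J)
    have "Q \<subseteq> carrier G" using Q.subset by simp
    then show ?case
      using insert Q.m_closed by (subst finsum_insert) (auto simp: Pi_iff)
  qed (use Q.one_closed in auto)
qed

text \<open>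
  The elements \<open>x\<^sub>i\<close> are the components of the unit vectors in the summand \<open>\<sigma>(M)\<close>, and the coordinate maps
  are those of the free module restricted along \<open>\<sigma>\<close>. Expanding \<open>\<sigma>(m)\<close> in unit vectors and comparing
  components in \<open>\<sigma>(M)\<close> gives the expansion of \<open>m\<close>.
\<close>

lemma projective_right_module_dual_basis:
  fixes R :: "('r, 'k) ring_scheme" and M :: "('r, 'a, 'm) module_scheme"
  assumes R: "ring R" and M: "abelian_group M"
    and smult: "\<And>r m. r \<in> carrier R \<Longrightarrow> m \<in> carrier M \<Longrightarrow> r \<odot>\<^bsub>M\<^esub> m \<in> carrier M"
    and fg: "finitely_generated_right_module R M" and proj: "projective_right_module R M"
  obtains J :: "'a set" and x f where "right_dual_basis R M J x f"
proof -
  interpret R: ring R by fact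
  interpret M: abelian_group M by fact
  from proj obtain I :: "'a set" and \<sigma> Q where
    \<sigma>: "\<sigma> \<in> right_module_hom R M (free_right_module R I)" and inj: "inj_on \<sigma> (carrier M)"
    and Q: "submodule Q R (free_right_module R I)"
    and int: "\<sigma> ` carrier M \<inter> Q = {\<zero>\<^bsub>free_right_module R I\<^esub>}"
    and sum: "\<sigma> ` carrier M <+>\<^bsub>free_right_module R I\<^esub> Q = carrier (free_right_module R I)"
    unfolding projective_right_module_def Let_def by blast
  let ?F = "free_right_module R I"
  interpret F: abelian_group ?F by (rule free_right_module_abelian_group [OF R])
  interpret Q: submodule Q R ?F by (rule Q)
  have QF: "q \<in> carrier ?F" if "q \<in> Q" for q using Q.subset that by auto
  interpret \<sigma>: group_hom "add_monoid M" "add_monoid ?F" \<sigma>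
    using right_module_homD(1) [OF \<sigma>] M.a_group F.a_group
    by (simp add: group_hom_def group_hom_axioms_def)
  note \<sigma>D = right_module_homD [OF \<sigma>]
  obtain J where J: "finite J" "J \<subseteq> I"
    and supp: "\<And>m i. m \<in> carrier M \<Longrightarrow> i \<notin> J \<Longrightarrow> \<sigma> m i = \<zero>\<^bsub>R\<^esub>"
    using finitely_generated_image_support [OF R M smult fg \<sigma>] by blast
  have "\<exists>m q. m \<in> carrier M \<and> q \<in> Q \<and> unit_vector R i = \<sigma> m \<oplus>\<^bsub>?F\<^esub> q" if "i \<in> J" for i
    using unit_vector_closed [OF R, of i I] that J(2) unfolding sum [symmetric] set_add_def'
    by blast
  then obtain x q where x: "\<And>i. i \<in> J \<Longrightarrow> x i \<in> carrier M" and q: "\<And>i. i \<in> J \<Longrightarrow> q i \<in> Q"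
    and unit: "\<And>i. i \<in> J \<Longrightarrow> unit_vector R i = \<sigma> (x i) \<oplus>\<^bsub>?F\<^esub> q i"
    by metis
  have co: "(\<lambda>m. \<sigma> m i) \<in> right_module_hom R M (natural_right_module R)" for i
    using \<sigma>D(2-4) right_module_homD(2-4) [OF free_right_module_coordinate [OF R, of i I]]
    by (intro right_module_homI) auto
  have "m = (\<Oplus>\<^bsub>M\<^esub>i\<in>J. \<sigma> m i \<odot>\<^bsub>M\<^esub> x i)" if m: "m \<in> carrier M" for m
  proof -
    define m' where "m' = (\<Oplus>\<^bsub>M\<^esub>i\<in>J. \<sigma> m i \<odot>\<^bsub>M\<^esub> x i)"
    define p where "p = (\<Oplus>\<^bsub>?F\<^esub>i\<in>J. \<sigma> m i \<odot>\<^bsub>?F\<^esub> q i)"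
    have c: "\<sigma> m i \<in> carrier R" for i using right_module_homD(2) [OF co m] by simp
    have xc: "(\<lambda>i. \<sigma> m i \<odot>\<^bsub>M\<^esub> x i) \<in> J \<rightarrow> carrier M" using c x smult by auto
    then have m': "m' \<in> carrier M" by (simp add: m'_def)
    have pQ: "p \<in> Q" unfolding p_def
      by (rule F.finsum_in_subgroup [OF Q.subgroup_axioms]) (use c q in auto)
    have \<sigma>x: "(\<lambda>i. \<sigma> m i \<odot>\<^bsub>?F\<^esub> \<sigma> (x i)) \<in> J \<rightarrow> carrier ?F"
      using c x \<sigma>D(2) by (auto intro!: free_right_module_smult_closed [OF R])
    have mq: "(\<lambda>i. \<sigma> m i \<odot>\<^bsub>?F\<^esub> q i) \<in> J \<rightarrow> carrier ?F"
      using c q QF by (auto intro!: free_right_module_smult_closed R)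
    have "\<sigma> m = (\<Oplus>\<^bsub>?F\<^esub>i\<in>J. \<sigma> m i \<odot>\<^bsub>?F\<^esub> unit_vector R i)"
      by (rule free_right_module_expand [OF R J \<sigma>D(2) [OF m] supp [OF m]])
    also have "\<dots> = (\<Oplus>\<^bsub>?F\<^esub>i\<in>J. \<sigma> m i \<odot>\<^bsub>?F\<^esub> \<sigma> (x i) \<oplus>\<^bsub>?F\<^esub> \<sigma> m i \<odot>\<^bsub>?F\<^esub> q i)"
    proof (rule F.finsum_cong')
      fix i assume i: "i \<in> J"
      have "\<sigma> (x i) j \<in> carrier R" "q i j \<in> carrier R" for j
        using right_module_homD(2) [OF free_right_module_coordinate [OF R, of j I]]
          \<sigma>D(2) [OF x [OF i]] QF [OF q [OF i]] by auto
      then show "\<sigma> m i \<odot>\<^bsub>?F\<^esub> unit_vector R i = \<sigma> m i \<odot>\<^bsub>?F\<^esub> \<sigma> (x i) \<oplus>\<^bsub>?F\<^esub> \<sigma> m i \<odot>\<^bsub>?F\<^esub> q i"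
        using c by (simp add: unit [OF i] free_right_module_def R.l_distr)
    qed (use \<sigma>x mq in auto)
    also have "\<dots> = (\<Oplus>\<^bsub>?F\<^esub>i\<in>J. \<sigma> m i \<odot>\<^bsub>?F\<^esub> \<sigma> (x i)) \<oplus>\<^bsub>?F\<^esub> p"
      unfolding p_def by (rule F.finsum_addf [OF \<sigma>x mq])
    also have "(\<Oplus>\<^bsub>?F\<^esub>i\<in>J. \<sigma> m i \<odot>\<^bsub>?F\<^esub> \<sigma> (x i)) = (\<Oplus>\<^bsub>?F\<^esub>i\<in>J. \<sigma> (\<sigma> m i \<odot>\<^bsub>M\<^esub> x i))"
      by (rule F.finsum_cong') (use \<sigma>x c x \<sigma>D(4) in auto)
    also have "\<dots> = \<sigma> m'"
      unfolding m'_def using hom_finsum [OF M F.abelian_group_axioms \<sigma>D(1) xc] by simp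
    finally have split: "\<sigma> m = \<sigma> m' \<oplus>\<^bsub>?F\<^esub> p" .
    have neg: "\<ominus>\<^bsub>M\<^esub> m' \<in> carrier M" using m' by simp
    \<comment> \<open>The error term \<open>p\<close> lies in the complement and in the image of \<open>\<sigma>\<close>, so it vanishes.\<close>
    have "\<sigma> (\<ominus>\<^bsub>M\<^esub> m' \<oplus>\<^bsub>M\<^esub> m) = p"
    proof -
      have "\<sigma> (\<ominus>\<^bsub>M\<^esub> m') \<oplus>\<^bsub>?F\<^esub> \<sigma> m' = \<zero>\<^bsub>?F\<^esub>"
        using \<sigma>D(3) [OF neg m'] \<sigma>.hom_one m' by (simp add: M.l_neg)
      then show ?thesis
        using \<sigma>D(3) [OF neg m] \<sigma>D(2) [OF neg] \<sigma>D(2) [OF m'] QF [OF pQ]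
        by (simp add: split F.a_assoc [symmetric])
    qed
    then have "p = \<zero>\<^bsub>?F\<^esub>"
      using int pQ neg m by (metis IntI M.a_closed image_eqI singletonD)
    then have "\<sigma> m = \<sigma> m'" using split \<sigma>D(2) [OF m'] by simp
    then show ?thesis using inj m m' by (auto simp: m'_def inj_on_def)
  qed
  then have "right_dual_basis R M J x (\<lambda>i m. \<sigma> m i)"
    using J x co by (auto simp: right_dual_basis_def)
  then show thesis by (rule that)
qed


section \<open>The tensor square and contraction by endomorphisms\<close>

locale ring_extension = ring A for A :: "('a, 'k) ring_scheme" (structure) +
  fixes B :: "'a set"
  assumes subring_B: "subring B A"
begin

abbreviation T :: "('a \<times> 'a \<Rightarrow>\<^sub>0 int) set monoid"
  where "T \<equiv> tensor_square A B"

abbreviation pure :: "'a \<Rightarrow> 'a \<Rightarrow> ('a \<times> 'a \<Rightarrow>\<^sub>0 int) set"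
  where "pure \<equiv> pure_tensor A B"

abbreviation End :: "('a \<Rightarrow> 'a) ring"
  where "End \<equiv> extension_End A B"

abbreviation right_linear :: "('a \<Rightarrow> 'a) set"
  where "right_linear \<equiv>
    right_module_hom (A\<lparr>carrier := B\<rparr>) (natural_right_module A) (natural_right_module A)"

lemma B_carrier: "b \<in> B \<Longrightarrow> b \<in> carrier A"
  using subringE(1) [OF subring_B] by blast

lemma comm_group_T: "comm_group T"
  by (rule tensor_square_comm_group [OF ring_axioms subring_B])

lemma comm_group_add: "comm_group (add_monoid A)"
  by (rule a_comm_group)

lemma right_linearD:
  assumes "\<alpha> \<in> right_linear"
  shows "\<alpha> \<in> hom (add_monoid A) (add_monoid A)"
    and "x \<in> carrier A \<Longrightarrow> \<alpha> x \<in> carrier A"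
    and "x \<in> carrier A \<Longrightarrow> y \<in> carrier A \<Longrightarrow> \<alpha> (x \<oplus> y) = \<alpha> x \<oplus> \<alpha> y"
    and "x \<in> carrier A \<Longrightarrow> b \<in> B \<Longrightarrow> \<alpha> (x \<otimes> b) = \<alpha> x \<otimes> b"
  using right_module_homD [OF assms] by (auto simp: hom_def)

lemma right_linearI:
  assumes "\<And>x. x \<in> carrier A \<Longrightarrow> \<alpha> x \<in> carrier A"
    and "\<And>x y. x \<in> carrier A \<Longrightarrow> y \<in> carrier A \<Longrightarrow> \<alpha> (x \<oplus> y) = \<alpha> x \<oplus> \<alpha> y"
    and "\<And>x b. x \<in> carrier A \<Longrightarrow> b \<in> B \<Longrightarrow> \<alpha> (x \<otimes> b) = \<alpha> x \<otimes> b"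
  shows "\<alpha> \<in> right_linear"
  by (rule right_module_homI) (use assms in auto)

lemma right_linear_left_mult:
  assumes "a \<in> carrier A"
  shows "(\<lambda>x. a \<otimes> x) \<in> right_linear"
  by (rule right_linearI) (use assms in \<open>auto simp: r_distr m_assoc B_carrier\<close>)

lemma right_linear_comp:
  assumes "\<alpha> \<in> right_linear" "\<beta> \<in> right_linear"
  shows "(\<lambda>x. \<alpha> (\<beta> x)) \<in> right_linear"
  by (rule right_linearI) (use right_linearD(2-) [OF assms(1)] right_linearD(2-) [OF assms(2)] in auto)

lemma right_linear_add:
  assumes "\<alpha> \<in> right_linear" "\<beta> \<in> right_linear"
  shows "(\<lambda>x. \<alpha> x \<oplus> \<beta> x) \<in> right_linear"
  by (rule right_linearI)
    (use right_linearD(2-) [OF assms(1)] right_linearD(2-) [OF assms(2)] in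
      \<open>auto simp: a_ac l_distr B_carrier\<close>)

lemma right_linear_restrict:
  assumes "\<alpha> \<in> right_linear"
  shows "restrict \<alpha> (carrier A) \<in> right_linear"
  by (rule right_linearI) (use right_linearD(2-) [OF assms] in \<open>auto simp: B_carrier\<close>)

text \<open>
  All the maps out of the tensor square that are used here come from multiplication or from the
  universal balanced map by applying a linear map in each argument.
\<close>

lemma balanced_map_comp:
  assumes g: "balanced_map A B G g" and \<alpha>: "\<alpha> \<in> right_linear"
    and \<psi>: "\<And>y. y \<in> carrier A \<Longrightarrow> \<psi> y \<in> carrier A"
      "\<And>y y'. y \<in> carrier A \<Longrightarrow> y' \<in> carrier A \<Longrightarrow> \<psi> (y \<oplus> y') = \<psi> y \<oplus> \<psi> y'"
      "\<And>b y. b \<in> B \<Longrightarrow> y \<in> carrier A \<Longrightarrow> \<psi> (b \<otimes> y) = b \<otimes> \<psi> y"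
  shows "balanced_map A B G (\<lambda>x y. g (\<alpha> x) (\<psi> y))"
  using g right_linearD(2-) [OF \<alpha>] \<psi> unfolding balanced_map_def by simp

lemma balanced_map_mult: "balanced_map A B (add_monoid A) (\<otimes>)"
  by (simp add: balanced_map_def l_distr r_distr m_assoc B_carrier)

lemma pure_closed: "x \<in> carrier A \<Longrightarrow> y \<in> carrier A \<Longrightarrow> pure x y \<in> carrier T"
  by (rule pure_tensor_closed)

lemma quotient_map_hom: "(\<lambda>u. tensor_kernel A B #>\<^bsub>pairs_group A\<^esub> u) \<in> hom (pairs_group A) T"
  unfolding tensor_square_def
  by (rule normal.r_coset_hom_Mod [OF tensor_kernel_normal [OF ring_axioms subring_B]])

lemma coset_eq_if_diff_relation:
  assumes "u \<in> carrier (pairs_group A)" "v \<in> carrier (pairs_group A)" "u - v \<in> tensor_relations A B"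
  shows "tensor_kernel A B #>\<^bsub>pairs_group A\<^esub> u = tensor_kernel A B #>\<^bsub>pairs_group A\<^esub> v"
proof -
  interpret K: normal "tensor_kernel A B" "pairs_group A"
    by (rule tensor_kernel_normal [OF ring_axioms subring_B])
  have "u - v \<in> tensor_kernel A B"
    unfolding tensor_kernel_def by (rule generate.incl) fact
  then have "u \<otimes>\<^bsub>pairs_group A\<^esub> inv\<^bsub>pairs_group A\<^esub> v \<in> tensor_kernel A B"
    using assms(2) by simp
  then have "u \<in> tensor_kernel A B #>\<^bsub>pairs_group A\<^esub> v"
    by (rule K.rcos_module_rev [OF group_free_Abelian_group assms(2,1)])
  then show ?thesis
    using K.repr_independence [OF _ assms(2) K.is_subgroup] by simp
qed

text \<open>Each defining relation of the tensor square is one of the three clauses of balancedness.\<close>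

lemma balanced_map_pure: "balanced_map A B T pure"
proof -
  let ?q = "\<lambda>u. tensor_kernel A B #>\<^bsub>pairs_group A\<^esub> u"
  have fc: "frag_of (x, y) \<in> carrier (pairs_group A)" if "x \<in> carrier A" "y \<in> carrier A" for x y
    using that by simp
  have ac: "u + v \<in> carrier (pairs_group A)"
    if "u \<in> carrier (pairs_group A)" "v \<in> carrier (pairs_group A)" for u v
    using that keys_add [of u v] by auto
  have q_add: "?q u \<otimes>\<^bsub>T\<^esub> ?q v = ?q (u + v)"
    if "u \<in> carrier (pairs_group A)" "v \<in> carrier (pairs_group A)" for u v
    using hom_mult [OF quotient_map_hom that] by simp
  show ?thesis
    unfolding balanced_map_def
  proof (intro conjI ballI)
    fix x x' y assume c: "x \<in> carrier A" "x' \<in> carrier A" "y \<in> carrier A"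
    have rel: "frag_of (x \<oplus> x', y) - (frag_of (x, y) + frag_of (x', y)) \<in> tensor_relations A B"
      unfolding tensor_relations_def diff_diff_eq [symmetric] using c by blast
    have "?q (frag_of (x \<oplus> x', y)) = ?q (frag_of (x, y) + frag_of (x', y))"
      by (rule coset_eq_if_diff_relation [OF fc ac [OF fc fc] rel]) (use c in simp_all)
    then show "pure (x \<oplus> x') y = pure x y \<otimes>\<^bsub>T\<^esub> pure x' y"
      unfolding pure_tensor_def q_add [OF fc [OF c(1,3)] fc [OF c(2,3)]] .
  next
    fix x y y' assume c: "x \<in> carrier A" "y \<in> carrier A" "y' \<in> carrier A"
    have rel: "frag_of (x, y \<oplus> y') - (frag_of (x, y) + frag_of (x, y')) \<in> tensor_relations A B"
      unfolding tensor_relations_def diff_diff_eq [symmetric] using c by blast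
    have "?q (frag_of (x, y \<oplus> y')) = ?q (frag_of (x, y) + frag_of (x, y'))"
      by (rule coset_eq_if_diff_relation [OF fc ac [OF fc fc] rel]) (use c in simp_all)
    then show "pure x (y \<oplus> y') = pure x y \<otimes>\<^bsub>T\<^esub> pure x y'"
      unfolding pure_tensor_def q_add [OF fc [OF c(1,2)] fc [OF c(1,3)]] .
  next
    fix x b y assume c: "x \<in> carrier A" "b \<in> B" "y \<in> carrier A"
    have rel: "frag_of (x \<otimes> b, y) - frag_of (x, b \<otimes> y) \<in> tensor_relations A B"
      using c unfolding tensor_relations_def by blast
    show "pure (x \<otimes> b) y = pure x (b \<otimes> y)"
      unfolding pure_tensor_def
      by (rule coset_eq_if_diff_relation [OF fc fc rel]) (use c B_carrier in simp_all)
  qed (rule pure_closed)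
qed

text \<open>
  Uniqueness in the universal property: the tensor square is a quotient of the free abelian group on
  pairs, so pure tensors generate it. Identities between maps that are additive in a tensor are all
  reduced to pure tensors in this way.
\<close>

lemma tensor_hom_eqI:
  assumes G: "group G" and h: "h \<in> hom T G" and k: "k \<in> hom T G"
    and eq: "\<And>x y. x \<in> carrier A \<Longrightarrow> y \<in> carrier A \<Longrightarrow> h (pure x y) = k (pure x y)"
    and t: "t \<in> carrier T"
  shows "h t = k t"
proof -
  let ?q = "\<lambda>u. tensor_kernel A B #>\<^bsub>pairs_group A\<^esub> u"
  have "group_hom (pairs_group A) G (h \<circ> ?q)" "group_hom (pairs_group A) G (k \<circ> ?q)"
    using hom_compose [OF quotient_map_hom h] hom_compose [OF quotient_map_hom k] G
    by (simp_all add: group_hom_def group_hom_axioms_def)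
  then interpret h: group_hom "pairs_group A" G "h \<circ> ?q" + k: group_hom "pairs_group A" G "k \<circ> ?q" .
  have "u \<in> carrier (pairs_group A) \<and> (h \<circ> ?q) u = (k \<circ> ?q) u"
    if "Poly_Mapping.keys u \<subseteq> carrier A \<times> carrier A" for u
    using that
  proof (induction u rule: frag_induction)
    case zero
    show ?case using h.hom_one k.hom_one by simp
  next
    case (one p)
    then show ?case using eq by (cases p) (simp add: pure_tensor_def)
  next
    case (diff u v)
    then have uv: "u \<in> carrier (pairs_group A)" "v \<in> carrier (pairs_group A)"
      and eq: "(h \<circ> ?q) u = (k \<circ> ?q) u" "(h \<circ> ?q) v = (k \<circ> ?q) v"
      by blast+
    let ?w = "inv\<^bsub>pairs_group A\<^esub> v"
    have w: "?w \<in> carrier (pairs_group A)" by (rule h.G.inv_closed [OF uv(2)])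
    have "u - v = u \<otimes>\<^bsub>pairs_group A\<^esub> ?w" using uv by simp
    moreover have "(h \<circ> ?q) (u \<otimes>\<^bsub>pairs_group A\<^esub> ?w) = (k \<circ> ?q) (u \<otimes>\<^bsub>pairs_group A\<^esub> ?w)"
      unfolding h.hom_mult [OF uv(1) w] k.hom_mult [OF uv(1) w] h.hom_inv [OF uv(2)] k.hom_inv [OF uv(2)]
        eq ..
    moreover have "u \<otimes>\<^bsub>pairs_group A\<^esub> ?w \<in> carrier (pairs_group A)"
      by (rule h.G.m_closed [OF uv(1) w])
    ultimately show ?case by (simp only: simp_thms)
  qed
  moreover obtain u where "u \<in> carrier (pairs_group A)" "t = ?q u"
    using t by (auto simp: tensor_square_def FactGroup_def RCOSETS_def)
  ultimately show ?thesis by simp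
qed

lemma pure_hom_left: "y \<in> carrier A \<Longrightarrow> (\<lambda>x. pure x y) \<in> hom (add_monoid A) T"
  and pure_hom_right: "x \<in> carrier A \<Longrightarrow> pure x \<in> hom (add_monoid A) T"
  and pure_middle: "x \<in> carrier A \<Longrightarrow> b \<in> B \<Longrightarrow> y \<in> carrier A \<Longrightarrow> pure (x \<otimes> b) y = pure x (b \<otimes> y)"
  using balanced_map_pure by (auto simp: balanced_map_def hom_def)

text \<open>
  The pairing \<open>\<alpha>(t\<^sup>1) t\<^sup>2\<close>. Unlike \<^const>\<open>separability_projection\<close> it accepts linear maps that are not
  restricted to the carrier, which avoids restrictions in intermediate computations.
\<close>

definition contraction :: "('a \<Rightarrow> 'a) \<Rightarrow> ('a \<times> 'a \<Rightarrow>\<^sub>0 int) set \<Rightarrow> 'a"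
  where "contraction \<alpha> = tensor_lift A (add_monoid A) (\<lambda>x y. \<alpha> x \<otimes> y)"

lemma
  assumes "\<alpha> \<in> right_linear"
  shows contraction_hom: "contraction \<alpha> \<in> hom T (add_monoid A)"
    and contraction_pure:
      "x \<in> carrier A \<Longrightarrow> y \<in> carrier A \<Longrightarrow> contraction \<alpha> (pure x y) = \<alpha> x \<otimes> y"
proof -
  have g: "balanced_map A B (add_monoid A) (\<lambda>x y. \<alpha> x \<otimes> y)"
    by (rule balanced_map_comp [OF balanced_map_mult assms]) auto
  show "contraction \<alpha> \<in> hom T (add_monoid A)"
    unfolding contraction_def by (rule tensor_lift_hom [OF ring_axioms subring_B comm_group_add g])
  show "contraction \<alpha> (pure x y) = \<alpha> x \<otimes> y" if "x \<in> carrier A" "y \<in> carrier A"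
    unfolding contraction_def by (rule tensor_lift_pure [OF ring_axioms subring_B comm_group_add g that])
qed

lemma contraction_closed: "\<alpha> \<in> right_linear \<Longrightarrow> t \<in> carrier T \<Longrightarrow> contraction \<alpha> t \<in> carrier A"
  using contraction_hom by (auto simp: hom_def)

lemma contraction_eqI:
  assumes "\<alpha> \<in> right_linear" "h \<in> hom T (add_monoid A)"
    and "\<And>x y. x \<in> carrier A \<Longrightarrow> y \<in> carrier A \<Longrightarrow> h (pure x y) = \<alpha> x \<otimes> y"
    and "t \<in> carrier T"
  shows "contraction \<alpha> t = h t"
  by (rule tensor_hom_eqI [OF a_group contraction_hom]) (use assms contraction_pure in auto)

lemma contraction_cong:
  assumes "\<alpha> \<in> right_linear" "\<beta> \<in> right_linear" "\<And>x. x \<in> carrier A \<Longrightarrow> \<alpha> x = \<beta> x" "t \<in> carrier T"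
  shows "contraction \<alpha> t = contraction \<beta> t"
  by (rule contraction_eqI [OF assms(1) contraction_hom [OF assms(2)]])
    (use assms contraction_pure in auto)

lemma contraction_add:
  assumes "\<alpha> \<in> right_linear" "\<beta> \<in> right_linear" "t \<in> carrier T"
  shows "contraction (\<lambda>x. \<alpha> x \<oplus> \<beta> x) t = contraction \<alpha> t \<oplus> contraction \<beta> t"
proof (rule contraction_eqI [OF right_linear_add [OF assms(1,2)]])
  show "(\<lambda>t. contraction \<alpha> t \<oplus> contraction \<beta> t) \<in> hom T (add_monoid A)"
    using contraction_hom [OF assms(1)] contraction_hom [OF assms(2)]
    by (auto simp: hom_def Pi_iff a_ac)
qed (use assms right_linearD(2) in \<open>auto simp: contraction_pure l_distr\<close>)

lemma contraction_mult:
  assumes "a \<in> carrier A" "\<alpha> \<in> right_linear" "t \<in> carrier T"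
  shows "contraction (\<lambda>x. a \<otimes> \<alpha> x) t = a \<otimes> contraction \<alpha> t"
proof (rule contraction_eqI [OF right_linear_comp [OF right_linear_left_mult [OF assms(1)] assms(2)]])
  show "(\<lambda>t. a \<otimes> contraction \<alpha> t) \<in> hom T (add_monoid A)"
    using contraction_hom [OF assms(2)] assms(1) by (auto simp: hom_def Pi_iff r_distr)
qed (use assms right_linearD(2) in \<open>auto simp: contraction_pure m_assoc\<close>)

lemma
  assumes "a \<in> carrier A"
  shows tensor_left_act_hom: "tensor_left_act A B a \<in> hom T T"
    and tensor_left_act_pure:
      "x \<in> carrier A \<Longrightarrow> y \<in> carrier A \<Longrightarrow> tensor_left_act A B a (pure x y) = pure (a \<otimes> x) y"
proof -
  have g: "balanced_map A B T (\<lambda>x y. pure (a \<otimes> x) y)"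
    by (rule balanced_map_comp [OF balanced_map_pure right_linear_left_mult [OF assms]]) auto
  show "tensor_left_act A B a \<in> hom T T"
    unfolding tensor_left_act_def by (rule tensor_lift_hom [OF ring_axioms subring_B comm_group_T g])
  show "tensor_left_act A B a (pure x y) = pure (a \<otimes> x) y" if "x \<in> carrier A" "y \<in> carrier A"
    unfolding tensor_left_act_def
    by (rule tensor_lift_pure [OF ring_axioms subring_B comm_group_T g that])
qed

lemma
  assumes "a \<in> carrier A"
  shows tensor_right_act_hom: "(\<lambda>t. tensor_right_act A B t a) \<in> hom T T"
    and tensor_right_act_pure:
      "x \<in> carrier A \<Longrightarrow> y \<in> carrier A \<Longrightarrow> tensor_right_act A B (pure x y) a = pure x (y \<otimes> a)"
proof -
  have id: "(\<lambda>x. x) \<in> right_linear" by (rule right_linearI) auto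
  have g: "balanced_map A B T (\<lambda>x y. pure x (y \<otimes> a))"
    by (rule balanced_map_comp [OF balanced_map_pure id])
      (use assms in \<open>auto simp: l_distr m_assoc B_carrier\<close>)
  show "(\<lambda>t. tensor_right_act A B t a) \<in> hom T T"
    unfolding tensor_right_act_def by (rule tensor_lift_hom [OF ring_axioms subring_B comm_group_T g])
  show "tensor_right_act A B (pure x y) a = pure x (y \<otimes> a)" if "x \<in> carrier A" "y \<in> carrier A"
    unfolding tensor_right_act_def
    by (rule tensor_lift_pure [OF ring_axioms subring_B comm_group_T g that])
qed

text \<open>
  The left action on tensors is absorbed by the endomorphism, whereas the right action passes to the
  value. Comparing the two is what links \<open>ae = ea\<close> to the right half of the bimodule property.
\<close>

lemma contraction_left_act:
  assumes "a \<in> carrier A" "\<alpha> \<in> right_linear" "t \<in> carrier T"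
  shows "contraction \<alpha> (tensor_left_act A B a t) = contraction (\<lambda>x. \<alpha> (a \<otimes> x)) t"
proof (rule sym, rule contraction_eqI [OF right_linear_comp [OF assms(2) right_linear_left_mult [OF assms(1)]]])
  show "(\<lambda>t. contraction \<alpha> (tensor_left_act A B a t)) \<in> hom T (add_monoid A)"
    using hom_compose [OF tensor_left_act_hom [OF assms(1)] contraction_hom [OF assms(2)]]
    by (simp add: comp_def)
qed (use assms in \<open>auto simp: tensor_left_act_pure contraction_pure\<close>)

lemma contraction_right_act:
  assumes "a \<in> carrier A" "\<alpha> \<in> right_linear" "t \<in> carrier T"
  shows "contraction \<alpha> (tensor_right_act A B t a) = contraction \<alpha> t \<otimes> a"
proof (rule tensor_hom_eqI [OF a_group _ _ _ assms(3)])
  show "(\<lambda>t. contraction \<alpha> (tensor_right_act A B t a)) \<in> hom T (add_monoid A)"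
    using hom_compose [OF tensor_right_act_hom [OF assms(1)] contraction_hom [OF assms(2)]]
    by (simp add: comp_def)
  show "(\<lambda>t. contraction \<alpha> t \<otimes> a) \<in> hom T (add_monoid A)"
    using contraction_hom [OF assms(2)] assms(1) by (auto simp: hom_def Pi_iff l_distr)
qed (use assms right_linearD(2) in \<open>auto simp: tensor_right_act_pure contraction_pure m_assoc\<close>)


section \<open>The endomorphism ring and its projections\<close>

lemma End_simps:
  "\<alpha> \<in> carrier End \<longleftrightarrow> \<alpha> \<in> right_linear \<and> \<alpha> \<in> extensional (carrier A)"
  "\<alpha> \<oplus>\<^bsub>End\<^esub> \<beta> = (\<lambda>x \<in> carrier A. \<alpha> x \<oplus> \<beta> x)"
  "\<alpha> \<otimes>\<^bsub>End\<^esub> \<beta> = (\<lambda>x \<in> carrier A. \<alpha> (\<beta> x))"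
  "\<one>\<^bsub>End\<^esub> = (\<lambda>x \<in> carrier A. x)"
  "\<zero>\<^bsub>End\<^esub> = (\<lambda>x \<in> carrier A. \<zero>)"
  by (simp_all add: right_module_End_def compose_def)

lemma restrict_in_End: "\<alpha> \<in> right_linear \<Longrightarrow> restrict \<alpha> (carrier A) \<in> carrier End"
  by (simp add: End_simps right_linear_restrict)

lemma End_abelian_group: "abelian_group End"
proof (rule abelian_groupI)
  fix \<alpha> \<beta> assume "\<alpha> \<in> carrier End" "\<beta> \<in> carrier End"
  then show "\<alpha> \<oplus>\<^bsub>End\<^esub> \<beta> \<in> carrier End"
    by (simp add: End_simps right_linear_restrict right_linear_add)
next
  have "(\<lambda>x. \<zero>) \<in> right_linear" by (rule right_linearI) (auto simp: B_carrier)
  then show "\<zero>\<^bsub>End\<^esub> \<in> carrier End" by (simp add: End_simps right_linear_restrict)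
next
  fix \<alpha> \<beta> \<gamma> assume "\<alpha> \<in> carrier End" "\<beta> \<in> carrier End" "\<gamma> \<in> carrier End"
  then show "\<alpha> \<oplus>\<^bsub>End\<^esub> \<beta> \<oplus>\<^bsub>End\<^esub> \<gamma> = \<alpha> \<oplus>\<^bsub>End\<^esub> (\<beta> \<oplus>\<^bsub>End\<^esub> \<gamma>)"
    by (auto simp: End_simps right_linearD(2) a_assoc intro!: restrict_ext)
next
  fix \<alpha> \<beta> assume "\<alpha> \<in> carrier End" "\<beta> \<in> carrier End"
  then show "\<alpha> \<oplus>\<^bsub>End\<^esub> \<beta> = \<beta> \<oplus>\<^bsub>End\<^esub> \<alpha>"
    by (auto simp: End_simps right_linearD(2) a_comm intro!: restrict_ext)
next
  fix \<alpha> assume \<alpha>: "\<alpha> \<in> carrier End"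
  then show "\<zero>\<^bsub>End\<^esub> \<oplus>\<^bsub>End\<^esub> \<alpha> = \<alpha>"
    by (auto simp: End_simps right_linearD(2) extensional_def)
  have l: "\<alpha> \<in> right_linear" using \<alpha> by (simp add: End_simps)
  have "(\<lambda>x. \<ominus> \<alpha> x) \<in> right_linear"
    by (rule right_linearI) (use right_linearD(2-) [OF l] in \<open>auto simp: minus_add l_minus B_carrier\<close>)
  then have "restrict (\<lambda>x. \<ominus> \<alpha> x) (carrier A) \<in> carrier End" by (rule restrict_in_End)
  moreover have "restrict (\<lambda>x. \<ominus> \<alpha> x) (carrier A) \<oplus>\<^bsub>End\<^esub> \<alpha> = \<zero>\<^bsub>End\<^esub>"
    by (auto simp: End_simps right_linearD(2) [OF l] l_neg)
  ultimately show "\<exists>\<beta> \<in> carrier End. \<beta> \<oplus>\<^bsub>End\<^esub> \<alpha> = \<zero>\<^bsub>End\<^esub>" by blast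
qed

text \<open>The one-sided linearity laws are the two-sided law with 1 on the other side.\<close>

lemma bimodule_projectionD:
  assumes E: "E \<in> bimodule_projections A B"
  shows "E \<in> hom (add_monoid End) (add_monoid A)"
    and "\<alpha> \<in> carrier End \<Longrightarrow> E \<alpha> \<in> carrier A"
    and "a \<in> carrier A \<Longrightarrow> \<alpha> \<in> carrier End \<Longrightarrow> E (\<lambda>x \<in> carrier A. a \<otimes> \<alpha> x) = a \<otimes> E \<alpha>"
    and "a \<in> carrier A \<Longrightarrow> \<alpha> \<in> carrier End \<Longrightarrow> E (\<lambda>x \<in> carrier A. \<alpha> (a \<otimes> x)) = E \<alpha> \<otimes> a"
    and "E (\<lambda>x \<in> carrier A. x) = \<one>"
proof -
  show hom: "E \<in> hom (add_monoid End) (add_monoid A)" and "E (\<lambda>x \<in> carrier A. x) = \<one>"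
    using E by (auto simp: bimodule_projections_def End_simps(4))
  have bi: "E (left_mult A a \<otimes>\<^bsub>End\<^esub> \<alpha> \<otimes>\<^bsub>End\<^esub> left_mult A a') = a \<otimes> E \<alpha> \<otimes> a'"
    if "a \<in> carrier A" "a' \<in> carrier A" "\<alpha> \<in> carrier End" for a a' \<alpha>
    using E that by (auto simp: bimodule_projections_def)
  show cl: "E \<alpha> \<in> carrier A" if "\<alpha> \<in> carrier End" for \<alpha>
    using hom that by (auto simp: hom_def)
  assume a: "a \<in> carrier A" and \<alpha>: "\<alpha> \<in> carrier End"
  have \<alpha>l: "\<alpha> \<in> right_linear" using \<alpha> by (simp add: End_simps)
  have "left_mult A a \<otimes>\<^bsub>End\<^esub> \<alpha> \<otimes>\<^bsub>End\<^esub> left_mult A \<one> = (\<lambda>x \<in> carrier A. a \<otimes> \<alpha> x)"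
    unfolding End_simps(3) left_mult_def by (rule restrict_ext) (use a right_linearD(2) [OF \<alpha>l] in simp)
  then show "E (\<lambda>x \<in> carrier A. a \<otimes> \<alpha> x) = a \<otimes> E \<alpha>"
    using bi [OF a one_closed \<alpha>] a cl [OF \<alpha>] by simp
  have "left_mult A \<one> \<otimes>\<^bsub>End\<^esub> \<alpha> \<otimes>\<^bsub>End\<^esub> left_mult A a = (\<lambda>x \<in> carrier A. \<alpha> (a \<otimes> x))"
    unfolding End_simps(3) left_mult_def by (rule restrict_ext) (use a right_linearD(2) [OF \<alpha>l] in simp)
  then show "E (\<lambda>x \<in> carrier A. \<alpha> (a \<otimes> x)) = E \<alpha> \<otimes> a"
    using bi [OF one_closed a \<alpha>] a cl [OF \<alpha>] by simp
qed

lemma separability_projection_apply: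
  "\<alpha> \<in> carrier End \<Longrightarrow> separability_projection A B e \<alpha> = contraction \<alpha> e"
  by (simp add: separability_projection_def contraction_def)

lemma tensor_lift_mult_eq_contraction:
  assumes "t \<in> carrier T"
  shows "tensor_lift A (add_monoid A) (\<otimes>) t = contraction (\<lambda>x \<in> carrier A. x) t"
proof -
  have id: "(\<lambda>x. x) \<in> right_linear" by (rule right_linearI) auto
  have "contraction (\<lambda>x. x) t = contraction (\<lambda>x \<in> carrier A. x) t"
    by (rule contraction_cong) (use id right_linear_restrict [OF id] assms in auto)
  then show ?thesis by (simp add: contraction_def)
qed

text \<open>
  The contraction with any tensor is left linear. Right linearity holds because
  \<open>\<alpha>(a'e\<^sup>1) e\<^sup>2 = \<alpha>(e\<^sup>1) e\<^sup>2 a'\<close>, by \<open>a'e = ea'\<close>.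
\<close>

lemma separability_projection_in_bimodule_projections:
  assumes e: "e \<in> separability_idempotents A B"
  shows "separability_projection A B e \<in> bimodule_projections A B"
proof -
  let ?E = "separability_projection A B e"
  have eT: "e \<in> carrier T" and comm: "\<And>a. a \<in> carrier A \<Longrightarrow> tensor_left_act A B a e = tensor_right_act A B e a"
    and one: "tensor_lift A (add_monoid A) (\<otimes>) e = \<one>"
    using e by (auto simp: separability_idempotents_def)
  have E_restrict: "?E (restrict \<alpha> (carrier A)) = contraction \<alpha> e" if "\<alpha> \<in> right_linear" for \<alpha>
    using contraction_cong [OF right_linear_restrict [OF that] that _ eT]
    by (simp add: separability_projection_apply restrict_in_End that)
  have lin: "\<alpha> \<in> right_linear" if "\<alpha> \<in> carrier End" for \<alpha> using that by (simp add: End_simps)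
  have "?E \<in> hom (add_monoid End) (add_monoid A)"
  proof (rule homI)
    fix \<alpha> \<beta> assume "\<alpha> \<in> carrier (add_monoid End)" "\<beta> \<in> carrier (add_monoid End)"
    then have c: "\<alpha> \<in> carrier End" "\<beta> \<in> carrier End" by simp_all
    show "?E (\<alpha> \<otimes>\<^bsub>add_monoid End\<^esub> \<beta>) = ?E \<alpha> \<otimes>\<^bsub>add_monoid A\<^esub> ?E \<beta>"
      using E_restrict [OF right_linear_add [OF c [THEN lin]]] contraction_add [OF c [THEN lin] eT]
      by (simp add: End_simps(2) separability_projection_apply c)
  qed (use lin eT in \<open>simp add: separability_projection_apply contraction_closed\<close>)
  moreover have "?E \<in> extensional (carrier End)"
    by (simp add: separability_projection_def)
  moreover have "?E (left_mult A a \<otimes>\<^bsub>End\<^esub> \<alpha> \<otimes>\<^bsub>End\<^esub> left_mult A a') = a \<otimes> ?E \<alpha> \<otimes> a'"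
    if a: "a \<in> carrier A" "a' \<in> carrier A" and \<alpha>: "\<alpha> \<in> carrier End" for a a' \<alpha>
  proof -
    note \<alpha>a' = right_linear_comp [OF lin [OF \<alpha>] right_linear_left_mult [OF a(2)]]
    have "left_mult A a \<otimes>\<^bsub>End\<^esub> \<alpha> \<otimes>\<^bsub>End\<^esub> left_mult A a' = (\<lambda>x \<in> carrier A. a \<otimes> \<alpha> (a' \<otimes> x))"
      unfolding End_simps(3) left_mult_def by (rule restrict_ext) (use a right_linearD(2) [OF lin [OF \<alpha>]] in simp)
    then have "?E (left_mult A a \<otimes>\<^bsub>End\<^esub> \<alpha> \<otimes>\<^bsub>End\<^esub> left_mult A a') = contraction (\<lambda>x. a \<otimes> \<alpha> (a' \<otimes> x)) e"
      using E_restrict [OF right_linear_comp [OF right_linear_left_mult [OF a(1)] \<alpha>a']] by simp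
    also have "\<dots> = a \<otimes> contraction (\<lambda>x. \<alpha> (a' \<otimes> x)) e"
      by (rule contraction_mult [OF a(1) \<alpha>a' eT])
    also have "contraction (\<lambda>x. \<alpha> (a' \<otimes> x)) e = contraction \<alpha> (tensor_left_act A B a' e)"
      using contraction_left_act [OF a(2) lin [OF \<alpha>] eT] by simp
    also have "\<dots> = contraction \<alpha> e \<otimes> a'"
      using contraction_right_act [OF a(2) lin [OF \<alpha>] eT] comm [OF a(2)] by simp
    finally show ?thesis
      using a contraction_closed [OF lin [OF \<alpha>] eT] by (simp add: separability_projection_apply \<alpha> m_assoc)
  qed
  moreover have "?E \<one>\<^bsub>End\<^esub> = \<one>"
  proof -
    have "(\<lambda>x \<in> carrier A. x) \<in> carrier End"
      by (rule restrict_in_End, rule right_linearI) auto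
    then show ?thesis
      using one by (simp add: End_simps(4) separability_projection_apply tensor_lift_mult_eq_contraction [OF eT])
  qed
  ultimately show ?thesis by (simp add: bimodule_projections_def)
qed

end


section \<open>Extensions with a dual basis\<close>

locale dual_basis_extension = ring_extension A B
  for A :: "('a, 'k) ring_scheme" (structure) and B +
  fixes J :: "'i set" and x :: "'i \<Rightarrow> 'a" and f :: "'i \<Rightarrow> 'a \<Rightarrow> 'a"
  assumes dual_basis: "right_dual_basis (A\<lparr>carrier := B\<rparr>) (natural_right_module A) J x f"
begin

lemma x_closed: "j \<in> J \<Longrightarrow> x j \<in> carrier A"
  using dual_basis by (auto simp: right_dual_basis_def)

lemma f_in_B: "j \<in> J \<Longrightarrow> a \<in> carrier A \<Longrightarrow> f j a \<in> B"
  and f_right_linear: "j \<in> J \<Longrightarrow> f j \<in> right_linear"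
proof -
  assume "j \<in> J"
  then have h: "f j \<in> right_module_hom (A\<lparr>carrier := B\<rparr>) (natural_right_module A)
      (natural_right_module (A\<lparr>carrier := B\<rparr>))"
    using dual_basis by (auto simp: right_dual_basis_def)
  show "f j a \<in> B" if "a \<in> carrier A" using right_module_homD(2) [OF h] that by simp
  show "f j \<in> right_linear"
    using right_module_homD(2-4) [OF h] by (intro right_linearI) (auto simp: B_carrier)
qed

text \<open>
  The dual basis identity with its sum taken in the ring \<open>A\<close> instead of the module: these are different
  records with the same addition, and the identity map is a homomorphism between them.
\<close>

lemma dual_basis_expand: "a \<in> carrier A \<Longrightarrow> (\<Oplus>j\<in>J. x j \<otimes> f j a) = a"
proof -
  assume a: "a \<in> carrier A"
  have "id \<in> hom (add_monoid (natural_right_module A)) (add_monoid A)" by (simp add: hom_def)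
  then have "(\<Oplus>\<^bsub>natural_right_module A\<^esub>j\<in>J. x j \<otimes> f j a) = (\<Oplus>j\<in>J. x j \<otimes> f j a)"
    using hom_finsum [OF natural_right_module_abelian_group [OF ring_axioms] abelian_group_axioms,
        of id "\<lambda>j. x j \<otimes> f j a" J] x_closed f_in_B a B_carrier by simp
  then show ?thesis using dual_basis a by (auto simp: right_dual_basis_def)
qed

text \<open>
  For \<open>t = u \<otimes> v\<close>: \<open>\<Sum>\<^sub>j x\<^sub>j \<otimes> f\<^sub>j(u)v = \<Sum>\<^sub>j x\<^sub>jf\<^sub>j(u) \<otimes> v = u \<otimes> v\<close>. Both sides are additive in \<open>t\<close>. The tensor
  square is a multiplicatively written group, so the sum appears as a product.
\<close>

lemma tensor_expand:
  assumes t: "t \<in> carrier T"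
  shows "t = finprod T (\<lambda>j. pure (x j) (contraction (f j) t)) J"
proof -
  interpret T: comm_group T by (rule comm_group_T)
  have hom: "(\<lambda>t. pure (x j) (contraction (f j) t)) \<in> hom T T" if "j \<in> J" for j
    using hom_compose [OF contraction_hom [OF f_right_linear [OF that]] pure_hom_right [OF x_closed [OF that]]]
    by (simp add: comp_def)
  have "(\<lambda>t. t) t = (\<lambda>t. finprod T (\<lambda>j. pure (x j) (contraction (f j) t)) J) t"
  proof (rule tensor_hom_eqI [OF T.group_axioms _ _ _ t])
    show "(\<lambda>t. finprod T (\<lambda>j. pure (x j) (contraction (f j) t)) J) \<in> hom T T"
      by (rule finprod_of_homs [OF T.group_axioms comm_group_T hom])
    fix u v assume uv: "u \<in> carrier A" "v \<in> carrier A"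
    have "finprod T (\<lambda>j. pure (x j) (contraction (f j) (pure u v))) J
        = finprod T (\<lambda>j. pure (x j \<otimes> f j u) v) J"
      using uv x_closed f_in_B f_right_linear
      by (intro T.finprod_cong') (auto simp: contraction_pure pure_middle B_carrier intro!: pure_closed)
    also have "\<dots> = pure (\<Oplus>j\<in>J. x j \<otimes> f j u) v"
      unfolding finsum_def
      by (rule hom_finprod [OF comm_group_add comm_group_T pure_hom_left [OF uv(2)], symmetric])
        (use uv x_closed f_in_B B_carrier in auto)
    also have "\<dots> = pure u v" by (simp add: dual_basis_expand uv)
    finally show "pure u v = finprod T (\<lambda>j. pure (x j) (contraction (f j) (pure u v))) J" by simp
  qed (simp add: hom_def)
  then show ?thesis .
qed

text \<open>A tensor can be recovered from its contractions with the \<open>f\<^sub>j\<close>.\<close>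

lemma tensor_eqI:
  assumes t: "t \<in> carrier T" and u: "u \<in> carrier T"
    and eq: "\<And>\<alpha>. \<alpha> \<in> carrier End \<Longrightarrow> contraction \<alpha> t = contraction \<alpha> u"
  shows "t = u"
proof -
  interpret T: comm_group T by (rule comm_group_T)
  have "contraction (f j) t = contraction (f j) u" if j: "j \<in> J" for j
    using eq [OF restrict_in_End [OF f_right_linear [OF j]]]
      contraction_cong [OF right_linear_restrict f_right_linear, OF f_right_linear, OF j j] t u
    by simp
  then have "finprod T (\<lambda>j. pure (x j) (contraction (f j) t)) J
      = finprod T (\<lambda>j. pure (x j) (contraction (f j) u)) J"
    by (intro T.finprod_cong')
      (use u x_closed f_right_linear in \<open>auto intro!: pure_closed contraction_closed\<close>)
  then show ?thesis using tensor_expand [OF t] tensor_expand [OF u] by simp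
qed

text \<open>
  Apply \<open>\<alpha>\<close> to the dual basis expansion of \<open>a\<close> and pull out the scalars \<open>f\<^sub>j(a)\<close>, which lie in \<open>B\<close>. As
  a left \<open>A\<close>-module, the endomorphism ring is thus generated by the \<open>f\<^sub>j\<close>, so left linearity of a projection
  reduces its values to those on the \<open>f\<^sub>j\<close>.
\<close>

lemma endomorphism_expand:
  assumes \<alpha>: "\<alpha> \<in> carrier End"
  shows "(\<Oplus>\<^bsub>End\<^esub>j\<in>J. (\<lambda>a \<in> carrier A. \<alpha> (x j) \<otimes> f j a)) = \<alpha>"
proof (rule extensionalityI [where A = "carrier A"])
  interpret E: abelian_group End by (rule End_abelian_group)
  have l: "\<alpha> \<in> right_linear" using \<alpha> by (simp add: End_simps)
  have c: "(\<lambda>j. \<lambda>a \<in> carrier A. \<alpha> (x j) \<otimes> f j a) \<in> J \<rightarrow> carrier End"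
    using right_linearD(2) [OF l] x_closed f_right_linear
    by (auto intro!: restrict_in_End right_linear_comp [OF right_linear_left_mult])
  then have "(\<Oplus>\<^bsub>End\<^esub>j\<in>J. (\<lambda>a \<in> carrier A. \<alpha> (x j) \<otimes> f j a)) \<in> carrier End" by (rule E.finsum_closed)
  then show "(\<Oplus>\<^bsub>End\<^esub>j\<in>J. (\<lambda>a \<in> carrier A. \<alpha> (x j) \<otimes> f j a)) \<in> extensional (carrier A)"
    by (simp add: End_simps)
  show "\<alpha> \<in> extensional (carrier A)" using \<alpha> by (simp add: End_simps)
  fix a assume a: "a \<in> carrier A"
  have fa: "f j a \<in> carrier A" if "j \<in> J" for j using f_in_B [OF that a] by (rule B_carrier)
  have "(\<lambda>\<beta>. \<beta> a) \<in> hom (add_monoid End) (add_monoid A)"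
    using a right_linearD(2) by (auto simp: hom_def End_simps)
  then have "(\<Oplus>\<^bsub>End\<^esub>j\<in>J. (\<lambda>a \<in> carrier A. \<alpha> (x j) \<otimes> f j a)) a
      = (\<Oplus>j\<in>J. (\<lambda>a \<in> carrier A. \<alpha> (x j) \<otimes> f j a) a)"
    by (rule hom_finsum [OF End_abelian_group abelian_group_axioms _ c])
  also have "\<dots> = (\<Oplus>j\<in>J. \<alpha> (x j \<otimes> f j a))"
    using a fa x_closed right_linearD(2,4) [OF l] f_in_B by (intro finsum_cong') auto
  also have "\<dots> = \<alpha> (\<Oplus>j\<in>J. x j \<otimes> f j a)"
    by (rule hom_finsum [OF abelian_group_axioms abelian_group_axioms right_linearD(1) [OF l], symmetric])
      (use fa x_closed in auto)
  finally show "(\<Oplus>\<^bsub>End\<^esub>j\<in>J. (\<lambda>a \<in> carrier A. \<alpha> (x j) \<otimes> f j a)) a = \<alpha> a"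
    by (simp add: dual_basis_expand a)
qed

text \<open>
  The tensor \<open>\<Sum>\<^sub>j x\<^sub>j \<otimes> E(f\<^sub>j)\<close>. By \<open>tensor_expand\<close> it is the only tensor whose contractions can agree
  with \<open>E\<close>; in particular it does not depend on the dual basis.
\<close>

definition projection_tensor :: "(('a \<Rightarrow> 'a) \<Rightarrow> 'a) \<Rightarrow> ('a \<times> 'a \<Rightarrow>\<^sub>0 int) set"
  where "projection_tensor E = finprod T (\<lambda>j. pure (x j) (E (restrict (f j) (carrier A)))) J"

lemma
  assumes E: "E \<in> bimodule_projections A B"
  shows projection_tensor_closed: "projection_tensor E \<in> carrier T"
    and contraction_projection_tensor:
      "\<alpha> \<in> carrier End \<Longrightarrow> contraction \<alpha> (projection_tensor E) = E \<alpha>"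
proof -
  interpret T: comm_group T by (rule comm_group_T)
  note ED = bimodule_projectionD [OF E]
  define g where "g = (\<lambda>j. restrict (f j) (carrier A))"
  have g: "g j \<in> carrier End" if "j \<in> J" for j
    using restrict_in_End [OF f_right_linear [OF that]] by (simp add: g_def)
  have pc: "(\<lambda>j. pure (x j) (E (g j))) \<in> J \<rightarrow> carrier T"
    using x_closed g ED(2) by (auto intro!: pure_closed)
  have tensor: "projection_tensor E = finprod T (\<lambda>j. pure (x j) (E (g j))) J"
    by (simp add: projection_tensor_def g_def)
  show "projection_tensor E \<in> carrier T" unfolding tensor using pc by simp
  assume \<alpha>: "\<alpha> \<in> carrier End"
  have l: "\<alpha> \<in> right_linear" using \<alpha> by (simp add: End_simps)
  have c: "(\<lambda>j. \<lambda>a \<in> carrier A. \<alpha> (x j) \<otimes> f j a) \<in> J \<rightarrow> carrier End"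
    using right_linearD(2) [OF l] x_closed f_right_linear
    by (auto intro!: restrict_in_End right_linear_comp [OF right_linear_left_mult])
  \<comment> \<open>Left linearity of \<open>E\<close> moves the factor \<open>\<alpha>(x\<^sub>j)\<close> inside.\<close>
  have term_eq: "contraction \<alpha> (pure (x j) (E (g j))) = E (\<lambda>a \<in> carrier A. \<alpha> (x j) \<otimes> f j a)"
    if j: "j \<in> J" for j
  proof -
    have "(\<lambda>a \<in> carrier A. \<alpha> (x j) \<otimes> f j a) = (\<lambda>a \<in> carrier A. \<alpha> (x j) \<otimes> g j a)"
      by (auto simp: g_def)
    then show ?thesis
      using ED(3) [OF right_linearD(2) [OF l x_closed [OF j]] g [OF j]]
        contraction_pure [OF l x_closed [OF j] ED(2) [OF g [OF j]]] by simp
  qed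
  have "contraction \<alpha> (projection_tensor E) = (\<Oplus>j\<in>J. contraction \<alpha> (pure (x j) (E (g j))))"
    unfolding tensor finsum_def by (rule hom_finprod [OF comm_group_T comm_group_add contraction_hom [OF l] pc])
  also have "\<dots> = (\<Oplus>j\<in>J. E (\<lambda>a \<in> carrier A. \<alpha> (x j) \<otimes> f j a))"
    by (rule finsum_cong') (use term_eq c ED(2) in auto)
  also have "\<dots> = E (\<Oplus>\<^bsub>End\<^esub>j\<in>J. (\<lambda>a \<in> carrier A. \<alpha> (x j) \<otimes> f j a))"
    by (rule hom_finsum [OF End_abelian_group abelian_group_axioms ED(1) c, symmetric])
  finally show "contraction \<alpha> (projection_tensor E) = E \<alpha>"
    by (simp add: endomorphism_expand [OF \<alpha>])
qed

text \<open>
  Equality of \<open>ae\<close> and \<open>ea\<close> is tested by contractions, where it becomes the right linearity of \<open>E\<close>: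
  \<open>E(\<alpha>\<lambda>\<^sub>a) = E(\<alpha>)a\<close>.
\<close>

lemma projection_tensor_in_separability_idempotents:
  assumes E: "E \<in> bimodule_projections A B"
  shows "projection_tensor E \<in> separability_idempotents A B"
proof -
  let ?e = "projection_tensor E"
  note ED = bimodule_projectionD [OF E] and eT = projection_tensor_closed [OF E]
    and contr = contraction_projection_tensor [OF E]
  have "tensor_left_act A B a ?e = tensor_right_act A B ?e a" if a: "a \<in> carrier A" for a
  proof (rule tensor_eqI)
    show "tensor_left_act A B a ?e \<in> carrier T" "tensor_right_act A B ?e a \<in> carrier T"
      using tensor_left_act_hom [OF a] tensor_right_act_hom [OF a] eT by (auto simp: hom_def)
    fix \<alpha> assume \<alpha>: "\<alpha> \<in> carrier End"
    have l: "\<alpha> \<in> right_linear" using \<alpha> by (simp add: End_simps)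
    have la: "(\<lambda>y. \<alpha> (a \<otimes> y)) \<in> right_linear"
      by (rule right_linear_comp [OF l right_linear_left_mult [OF a]])
    have "contraction \<alpha> (tensor_left_act A B a ?e) = contraction (\<lambda>y \<in> carrier A. \<alpha> (a \<otimes> y)) ?e"
      unfolding contraction_left_act [OF a l eT]
      by (rule contraction_cong [OF la right_linear_restrict [OF la] _ eT]) simp
    also have "\<dots> = E \<alpha> \<otimes> a"
      using contr [OF restrict_in_End [OF la]] ED(4) [OF a \<alpha>] by simp
    also have "\<dots> = contraction \<alpha> (tensor_right_act A B ?e a)"
      by (simp add: contraction_right_act [OF a l eT] contr \<alpha>)
    finally show "contraction \<alpha> (tensor_left_act A B a ?e) = contraction \<alpha> (tensor_right_act A B ?e a)" .
  qed
  moreover have "tensor_lift A (add_monoid A) (\<otimes>) ?e = \<one>"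
  proof -
    have "(\<lambda>y \<in> carrier A. y) \<in> carrier End"
      by (rule restrict_in_End, rule right_linearI) auto
    then show ?thesis by (simp add: tensor_lift_mult_eq_contraction [OF eT] contr ED(5))
  qed
  ultimately show ?thesis using eT by (simp add: separability_idempotents_def)
qed

lemma separability_projection_bij:
  "bij_betw (separability_projection A B) (separability_idempotents A B) (bimodule_projections A B)"
proof (rule bij_betw_imageI)
  show "inj_on (separability_projection A B) (separability_idempotents A B)"
  proof (rule inj_onI)
    fix e e' assume e: "e \<in> separability_idempotents A B" "e' \<in> separability_idempotents A B"
      and eq: "separability_projection A B e = separability_projection A B e'"
    show "e = e'"
    proof (rule tensor_eqI)
      show "e \<in> carrier T" "e' \<in> carrier T" using e by (auto simp: separability_idempotents_def)
      show "contraction \<alpha> e = contraction \<alpha> e'" if "\<alpha> \<in> carrier End" for \<alpha>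
        using fun_cong [OF eq, of \<alpha>] by (simp add: separability_projection_apply that)
    qed
  qed
  have "E \<in> separability_projection A B ` separability_idempotents A B"
    if E: "E \<in> bimodule_projections A B" for E
  proof (rule image_eqI [OF _ projection_tensor_in_separability_idempotents [OF E]])
    show "E = separability_projection A B (projection_tensor E)"
    proof (rule extensionalityI [where A = "carrier End"])
      show "E \<in> extensional (carrier End)" using E by (simp add: bimodule_projections_def)
      show "separability_projection A B (projection_tensor E) \<in> extensional (carrier End)"
        by (simp add: separability_projection_def)
    qed (simp add: separability_projection_apply contraction_projection_tensor [OF E])
  qed
  then show "separability_projection A B ` separability_idempotents A B = bimodule_projections A B"
    using separability_projection_in_bimodule_projections by blast
qed

end


section \<open>The correspondence\<close>

theorem theorem3p1:
  fixes A :: "('a, 'k) ring_scheme" and B :: "'a set"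
  assumes "ring A" and "subring B A"
    and "finitely_generated_right_module (A\<lparr>carrier := B\<rparr>) (natural_right_module A)"
    and "projective_right_module (A\<lparr>carrier := B\<rparr>) (natural_right_module A)"
  shows "bij_betw (separability_projection A B)
           (separability_idempotents A B) (bimodule_projections A B)"
proof -
  interpret ring_extension A B
    using assms(1,2) by (simp add: ring_extension_def ring_extension_axioms_def)
  have "r \<odot>\<^bsub>natural_right_module A\<^esub> m \<in> carrier (natural_right_module A)"
    if "r \<in> carrier (A\<lparr>carrier := B\<rparr>)" "m \<in> carrier (natural_right_module A)" for r m
    using that B_carrier by simp
  then obtain J :: "'a set" and x f
    where "right_dual_basis (A\<lparr>carrier := B\<rparr>) (natural_right_module A) J x f"
    using projective_right_module_dual_basis [OF subring_is_ring [OF assms(2)]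
        natural_right_module_abelian_group [OF assms(1)] _ assms(3,4)] by blast
  then interpret dual_basis_extension A B J x f
    by unfold_locales
  show ?thesis by (rule separability_projection_bij)
qed

end
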